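(* Let $T$ be a trigraph in $\mathcal F$ that contains no antihole (of any length $\ge5$) and that is either the complement of a bipartite trigraph or the complement of a line trigraph. Then: (1) $T$ is either complete or has an even pair; (2) if $T$ is favorable, then $T$ has an even pair disjoint from its switchable component.
   Context: A trigraph $T$ consists of a finite set $V(T)$ and a map $\theta:\binom{V(T)}{2}\to\{-1,0,1\}$. Two distinct vertices $u,v$ are strongly adjacent if $\theta(uv)=1$, strongly antiadjacent if $\theta(uv)=-1$, and semiadjacent (a switchable pair) if $\theta(uv)=0$; they are adjacent if $\theta(uv)\in\{0,1\}$ and antiadjacent if $\theta(uv)\in\{0,-1\}$. $N(v)$ is the set of vertices adjacent to $v$. The complement $\overline T$ has vertex set $V(T)$ and adjacency function $-\theta$. For $X\subseteq V(T)$, $T|X$ is the trigraph on $X$ with $\theta$ restricted, and $T\setminus X=T|(V(T)\setminus X)$; $T$ contains $H$ if $H$ is isomorphic to some $T|X$. A clique (strong clique) is a set of pairwise adjacent (strongly adjacent) vertices; a strongly stable set is a set of pairwise strongly antiadjacent vertices; $T$ is complete if $V(T)$ is a clique. The full realization of $T$ is the graph on $V(T)$ whose edges are the adjacent pairs. A path is a sequence of distinct vertices $p_1,\dots,p_k$ such that $p_i,p_j$ are adjacent when $|i-j|=1$ and antiadjacent when $|i-j|>1$; its length is $k-1$. A hole of length $k\ge5$ consists of vertices $h_1,\dots,h_k$ with $h_i,h_j$ adjacent if $|i-j|\in\{1,k-1\}$ and antiadjacent otherwise; an antihole is an induced subtrigraph whose complement is a hole of $\overline T$ (length = number of vertices).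 $T$ is Berge if it contains no hole of odd length and no antihole of odd length. An even pair of $T$ is a strongly antiadjacent pair $\{u,v\}$ such that every path from $u$ to $v$ in $T$ has even length. $\Sigma(T)$ is the graph on $V(T)$ whose edges are the switchable pairs of $T$; a switchable component is a connected component of $\Sigma(T)$ with at least two vertices. $\mathcal F$ is the class of Berge trigraphs $T$ such that: (1) $T$ has at most one switchable component, and it has at most two edges; (2) if the switchable component has exactly one edge $xy$, then $N(x)\cap N(y)=\emptyset$ (it is called small); (3) if it has two edges, with $v$ the vertex of degree two in $\Sigma(T)$ and $x,y$ its neighbours, then $v$ is strongly anticomplete to $V(T)\setminus\{v,x,y\}$, $x$ is strongly antiadjacent to $y$, and $N(x)\cap N(y)=\{v\}$ (it is called light). For $T\in\mathcal F$, $D$ denotes the vertex set of its switchable component ($D=\emptyset$ if $T$ has no switchable pair). A pair $\{u,v\}$ is disjoint from the switchable component if $\{u,v\}\cap D=\emptyset$. A trigraph $T\in\mathcal F$ is favorable if (1) $|V(T)|\ge5$; (2) $T$ has a strongly antiadjacent pair $\{u,v\}$ disjoint from $D$; and (3) if $D=\{x,y\}$ is small, then at least one of $V(T)\setminus(D\cup N(x))$, $V(T)\setminus(D\cup N(y))$ is not a clique. $T$ is bipartite if $V(T)$ can be partitioned into two strongly stable sets. $T$ is a line trigraph if its full realization is the line graph of a bipartite graph and every clique of size at least $3$ in $T$ is a strong clique. $T$ is the complement of a bipartite (line) trigraph if $\overline T$ is a bipartite (line) trigraph. *)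

theory Defs
  imports Main
begin

text \<open>A trigraph is a finite vertex set V together with a symmetric map th on pairs of
distinct vertices taking values in {-1,0,1}; the value of th on pairs (u,u) or on
vertices outside V is irrelevant.\<close>

definition trigraph :: "'a set \<Rightarrow> ('a \<Rightarrow> 'a \<Rightarrow> int) \<Rightarrow> bool" where
  "trigraph V th \<longleftrightarrow> finite V \<and>
     (\<forall>u\<in>V. \<forall>v\<in>V. u \<noteq> v \<longrightarrow> th u v = th v u \<and> th u v \<in> {-1, 0, 1})"

definition strongly_adj :: "('a \<Rightarrow> 'a \<Rightarrow> int) \<Rightarrow> 'a \<Rightarrow> 'a \<Rightarrow> bool" where
  "strongly_adj th u v \<longleftrightarrow> u \<noteq> v \<and> th u v = 1"

definition strongly_anti :: "('a \<Rightarrow> 'a \<Rightarrow> int) \<Rightarrow> 'a \<Rightarrow> 'a \<Rightarrow> bool" where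
  "strongly_anti th u v \<longleftrightarrow> u \<noteq> v \<and> th u v = -1"

definition semiadj :: "('a \<Rightarrow> 'a \<Rightarrow> int) \<Rightarrow> 'a \<Rightarrow> 'a \<Rightarrow> bool" where
  "semiadj th u v \<longleftrightarrow> u \<noteq> v \<and> th u v = 0"

definition adj :: "('a \<Rightarrow> 'a \<Rightarrow> int) \<Rightarrow> 'a \<Rightarrow> 'a \<Rightarrow> bool" where
  "adj th u v \<longleftrightarrow> u \<noteq> v \<and> th u v \<in> {0, 1}"

definition antiadj :: "('a \<Rightarrow> 'a \<Rightarrow> int) \<Rightarrow> 'a \<Rightarrow> 'a \<Rightarrow> bool" where
  "antiadj th u v \<longleftrightarrow> u \<noteq> v \<and> th u v \<in> {0, -1}"

definition nbhd :: "'a set \<Rightarrow> ('a \<Rightarrow> 'a \<Rightarrow> int) \<Rightarrow> 'a \<Rightarrow> 'a set" where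
  "nbhd V th v = {u \<in> V. adj th v u}"

definition compl_th :: "('a \<Rightarrow> 'a \<Rightarrow> int) \<Rightarrow> 'a \<Rightarrow> 'a \<Rightarrow> int" where
  "compl_th th = (\<lambda>u v. - th u v)"

definition clique :: "('a \<Rightarrow> 'a \<Rightarrow> int) \<Rightarrow> 'a set \<Rightarrow> bool" where
  "clique th X \<longleftrightarrow> (\<forall>u\<in>X. \<forall>v\<in>X. u \<noteq> v \<longrightarrow> adj th u v)"

definition strong_clique :: "('a \<Rightarrow> 'a \<Rightarrow> int) \<Rightarrow> 'a set \<Rightarrow> bool" where
  "strong_clique th X \<longleftrightarrow> (\<forall>u\<in>X. \<forall>v\<in>X. u \<noteq> v \<longrightarrow> strongly_adj th u v)"

definition strongly_stable :: "('a \<Rightarrow> 'a \<Rightarrow> int) \<Rightarrow> 'a set \<Rightarrow> bool" where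
  "strongly_stable th X \<longleftrightarrow> (\<forall>u\<in>X. \<forall>v\<in>X. u \<noteq> v \<longrightarrow> strongly_anti th u v)"

definition complete :: "'a set \<Rightarrow> ('a \<Rightarrow> 'a \<Rightarrow> int) \<Rightarrow> bool" where
  "complete V th \<longleftrightarrow> clique th V"

definition is_path :: "'a set \<Rightarrow> ('a \<Rightarrow> 'a \<Rightarrow> int) \<Rightarrow> 'a list \<Rightarrow> bool" where
  "is_path V th ps \<longleftrightarrow> ps \<noteq> [] \<and> distinct ps \<and> set ps \<subseteq> V \<and>
     (\<forall>i<length ps. \<forall>j<length ps.
        (j = i + 1 \<longrightarrow> adj th (ps ! i) (ps ! j)) \<and>
        (j > i + 1 \<longrightarrow> antiadj th (ps ! i) (ps ! j)))"

definition cyc_adj_idx :: "nat \<Rightarrow> nat \<Rightarrow> nat \<Rightarrow> bool" where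
  "cyc_adj_idx k i j \<longleftrightarrow> i = j + 1 \<or> j = i + 1 \<or> (i = 0 \<and> j = k - 1) \<or> (j = 0 \<and> i = k - 1)"

definition has_hole_len :: "'a set \<Rightarrow> ('a \<Rightarrow> 'a \<Rightarrow> int) \<Rightarrow> nat \<Rightarrow> bool" where
  "has_hole_len V th k \<longleftrightarrow> k \<ge> 5 \<and> (\<exists>h :: nat \<Rightarrow> 'a. inj_on h {0..<k} \<and> h ` {0..<k} \<subseteq> V \<and>
     (\<forall>i<k. \<forall>j<k. i \<noteq> j \<longrightarrow>
        (cyc_adj_idx k i j \<longrightarrow> adj th (h i) (h j)) \<and>
        (\<not> cyc_adj_idx k i j \<longrightarrow> antiadj th (h i) (h j))))"

definition has_antihole_len :: "'a set \<Rightarrow> ('a \<Rightarrow> 'a \<Rightarrow> int) \<Rightarrow> nat \<Rightarrow> bool" where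
  "has_antihole_len V th k \<longleftrightarrow> has_hole_len V (compl_th th) k"

definition has_antihole :: "'a set \<Rightarrow> ('a \<Rightarrow> 'a \<Rightarrow> int) \<Rightarrow> bool" where
  "has_antihole V th \<longleftrightarrow> (\<exists>k. has_antihole_len V th k)"

definition berge :: "'a set \<Rightarrow> ('a \<Rightarrow> 'a \<Rightarrow> int) \<Rightarrow> bool" where
  "berge V th \<longleftrightarrow> (\<forall>k. odd k \<longrightarrow> \<not> has_hole_len V th k \<and> \<not> has_antihole_len V th k)"

definition even_pair :: "'a set \<Rightarrow> ('a \<Rightarrow> 'a \<Rightarrow> int) \<Rightarrow> 'a \<Rightarrow> 'a \<Rightarrow> bool" where
  "even_pair V th u v \<longleftrightarrow> u \<in> V \<and> v \<in> V \<and> strongly_anti th u v \<and>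
     (\<forall>ps. is_path V th ps \<and> hd ps = u \<and> last ps = v \<longrightarrow> even (length ps - 1))"

definition sw_edges :: "'a set \<Rightarrow> ('a \<Rightarrow> 'a \<Rightarrow> int) \<Rightarrow> 'a set set" where
  "sw_edges V th = {{u, v} | u v. u \<in> V \<and> v \<in> V \<and> semiadj th u v}"

definition sw_comp :: "'a set \<Rightarrow> ('a \<Rightarrow> 'a \<Rightarrow> int) \<Rightarrow> 'a \<Rightarrow> 'a set" where
  "sw_comp V th x = {y \<in> V. (\<lambda>a b. {a, b} \<in> sw_edges V th)\<^sup>*\<^sup>* x y}"

definition sw_components :: "'a set \<Rightarrow> ('a \<Rightarrow> 'a \<Rightarrow> int) \<Rightarrow> 'a set set" where
  "sw_components V th = {sw_comp V th x | x. x \<in> V \<and> card (sw_comp V th x) \<ge> 2}"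

definition comp_edges :: "'a set \<Rightarrow> ('a \<Rightarrow> 'a \<Rightarrow> int) \<Rightarrow> 'a set \<Rightarrow> 'a set set" where
  "comp_edges V th C = {e \<in> sw_edges V th. e \<subseteq> C}"

text \<open>D: vertex set of the switchable component (empty if there is none).\<close>
definition swD :: "'a set \<Rightarrow> ('a \<Rightarrow> 'a \<Rightarrow> int) \<Rightarrow> 'a set" where
  "swD V th = \<Union> (sw_components V th)"

definition in_F :: "'a set \<Rightarrow> ('a \<Rightarrow> 'a \<Rightarrow> int) \<Rightarrow> bool" where
  "in_F V th \<longleftrightarrow> trigraph V th \<and> berge V th \<and>
     card (sw_components V th) \<le> 1 \<and>
     (\<forall>C\<in>sw_components V th. card (comp_edges V th C) \<le> 2) \<and>
     (\<forall>C\<in>sw_components V th. \<forall>x y. comp_edges V th C = {{x, y}} \<longrightarrow>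
         nbhd V th x \<inter> nbhd V th y = {}) \<and>
     (\<forall>C\<in>sw_components V th. \<forall>v x y. x \<noteq> y \<and> comp_edges V th C = {{v, x}, {v, y}} \<longrightarrow>
         (\<forall>w\<in>V - {v, x, y}. strongly_anti th v w) \<and> strongly_anti th x y \<and>
         nbhd V th x \<inter> nbhd V th y = {v})"

definition small_D :: "'a set \<Rightarrow> ('a \<Rightarrow> 'a \<Rightarrow> int) \<Rightarrow> 'a \<Rightarrow> 'a \<Rightarrow> bool" where
  "small_D V th x y \<longleftrightarrow> (\<exists>C\<in>sw_components V th. comp_edges V th C = {{x, y}})"

definition favorable :: "'a set \<Rightarrow> ('a \<Rightarrow> 'a \<Rightarrow> int) \<Rightarrow> bool" where
  "favorable V th \<longleftrightarrow> in_F V th \<and> card V \<ge> 5 \<and>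
     (\<exists>u\<in>V. \<exists>v\<in>V. strongly_anti th u v \<and> {u, v} \<inter> swD V th = {}) \<and>
     (\<forall>x y. swD V th = {x, y} \<and> small_D V th x y \<longrightarrow>
        \<not> clique th (V - (swD V th \<union> nbhd V th x)) \<or>
        \<not> clique th (V - (swD V th \<union> nbhd V th y)))"

definition bipartite_tri :: "'a set \<Rightarrow> ('a \<Rightarrow> 'a \<Rightarrow> int) \<Rightarrow> bool" where
  "bipartite_tri V th \<longleftrightarrow> (\<exists>A B. A \<union> B = V \<and> A \<inter> B = {} \<and>
     strongly_stable th A \<and> strongly_stable th B)"

text \<open>A simple bipartite graph given by its edge set (2-element sets of vertices).
Vertices are taken to be natural numbers; since line graphs of bipartite graphs are
closed under isomorphism and every finite graph can be relabelled, this is no loss.\<close>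
definition bipartite_graph :: "nat set set \<Rightarrow> bool" where
  "bipartite_graph E \<longleftrightarrow> finite E \<and> (\<forall>e\<in>E. card e = 2) \<and>
     (\<exists>A. \<forall>e\<in>E. card (e \<inter> A) = 1)"

definition full_real_is_line_of_bipartite :: "'a set \<Rightarrow> ('a \<Rightarrow> 'a \<Rightarrow> int) \<Rightarrow> bool" where
  "full_real_is_line_of_bipartite V th \<longleftrightarrow> (\<exists>(E :: nat set set) f. bipartite_graph E \<and>
     bij_betw f V E \<and>
     (\<forall>u\<in>V. \<forall>v\<in>V. u \<noteq> v \<longrightarrow> (adj th u v \<longleftrightarrow> f u \<inter> f v \<noteq> {})))"

definition line_tri :: "'a set \<Rightarrow> ('a \<Rightarrow> 'a \<Rightarrow> int) \<Rightarrow> bool" where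
  "line_tri V th \<longleftrightarrow> full_real_is_line_of_bipartite V th \<and>
     (\<forall>X\<subseteq>V. clique th X \<and> card X \<ge> 3 \<longrightarrow> strong_clique th X)"

definition compl_bipartite_tri :: "'a set \<Rightarrow> ('a \<Rightarrow> 'a \<Rightarrow> int) \<Rightarrow> bool" where
  "compl_bipartite_tri V th \<longleftrightarrow> bipartite_tri V (compl_th th)"

definition compl_line_tri :: "'a set \<Rightarrow> ('a \<Rightarrow> 'a \<Rightarrow> int) \<Rightarrow> bool" where
  "compl_line_tri V th \<longleftrightarrow> line_tri V (compl_th th)"

end

(* Work in the complement H, where T-cliques and T-paths become stable sets and co-paths. The light
   switchable component cannot occur, because it is a triangle of H with switchable pairs, and an odd
   path of T with at least six vertices would give a diamond in H. Hence an even pair is a strong edge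
   u v of H that is not the middle edge of an induced P4.

   If H is bipartite without holes, such an edge is a bisimplicial one. Maximise the sum of
   2^rho(u) * 2^gamma(v) over the edges u v, where rho and gamma number the two sides: the adjacency
   matrix is then lexically ordered in both rows and columns. A forbidden Gamma configuration in it could be
   prolonged forever, so there is none, and the first nonzero entry is bisimplicial.

   If H is a line trigraph without holes, the first two vertices u, v of a longest induced path work:
   if p u v q is a P4, then p sees the third vertex of the path, so exchanging the first vertices
   gives the longest induced path v, u, p, ..., and by the same argument q sees p.

   If T is favorable with a small component {x, y}, then H is not bipartite, and any two strongly
   antiadjacent vertices outside D and N(x) (or N(y)) form the required even pair, because the line
   trigraph H has no claw and no diamond. *)
theory Submission
  imports Defs
begin

subsection \<open>Doubly lexical orderings\<close>

text \<open>Holes of either parity are forbidden while 4-cycles are allowed. The indexing by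
  \<open>cyc_adj_idx\<close> is that of \<open>has_hole_len\<close>, so a hole of the complement
  graph translates directly into an antihole.\<close>

definition hole_free :: "'a set \<Rightarrow> ('a \<Rightarrow> 'a \<Rightarrow> bool) \<Rightarrow> bool" where
  "hole_free V E \<longleftrightarrow> \<not> (\<exists>k\<ge>5. \<exists>h. inj_on h {0..<k} \<and> h ` {0..<k} \<subseteq> V \<and>
     (\<forall>i<k. \<forall>j<k. i \<noteq> j \<longrightarrow> (E (h i) (h j) \<longleftrightarrow> cyc_adj_idx k i j)))"

text \<open>Exchange argument: if \<open>F u > F v\<close> although \<open>u\<close> has the lower
  rank, swapping the two ranks raises the sum by
  \<open>(F u - F v) * (2 ^ \<rho> v - 2 ^ \<rho> u)\<close>.\<close>

lemma weighted_sum_max_sorted: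
  fixes F \<rho> :: "'a \<Rightarrow> nat"
  assumes "finite A" and inj: "inj_on \<rho> A" and bd: "\<rho> ` A \<subseteq> {..<n}"
    and mx: "\<And>\<rho>'. inj_on \<rho>' A \<Longrightarrow> \<rho>' ` A \<subseteq> {..<n} \<Longrightarrow> (\<Sum>u\<in>A. F u * 2 ^ \<rho>' u) \<le> (\<Sum>u\<in>A. F u * 2 ^ \<rho> u)"
    and uv: "u \<in> A" "v \<in> A" "\<rho> u < \<rho> v"
  shows "F u \<le> F v"
proof (rule ccontr)
  assume "\<not> F u \<le> F v"
  hence gt: "F v < F u" by simp
  define \<sigma> where "\<sigma> = \<rho>(u := \<rho> v, v := \<rho> u)"
  have ne: "u \<noteq> v" using uv by auto
  have "inj_on \<sigma> A"
    using inj uv ne by (auto simp: \<sigma>_def inj_on_def)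
  moreover have "\<sigma> ` A \<subseteq> {..<n}"
    using bd uv by (auto simp: \<sigma>_def)
  ultimately have le: "(\<Sum>u\<in>A. F u * 2 ^ \<sigma> u) \<le> (\<Sum>u\<in>A. F u * 2 ^ \<rho> u)" by (rule mx)
  have split: "(\<Sum>w\<in>A. G w) = G u + (G v + (\<Sum>w\<in>A - {u} - {v}. G w))" for G :: "'a \<Rightarrow> nat"
    using assms(1) uv ne by (subst sum.remove[of A u], simp_all, subst sum.remove[of "A - {u}" v]) auto
  have rest: "(\<Sum>w\<in>A - {u} - {v}. F w * 2 ^ \<sigma> w) = (\<Sum>w\<in>A - {u} - {v}. F w * 2 ^ \<rho> w)"
    by (rule sum.cong) (auto simp: \<sigma>_def)
  have "F u * 2 ^ \<rho> v + F v * 2 ^ \<rho> u \<le> F u * 2 ^ \<rho> u + F v * 2 ^ \<rho> v"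
    using le ne unfolding split rest by (simp add: \<sigma>_def)
  moreover obtain d where d: "F u = F v + d" "d > 0"
    using gt less_imp_add_positive[OF gt] by (auto simp: eq_commute)
  ultimately have "d * 2 ^ \<rho> v \<le> d * 2 ^ \<rho> u" by (simp add: algebra_simps)
  with d have "(2::nat) ^ \<rho> v \<le> 2 ^ \<rho> u" by simp
  with uv(3) show False by simp
qed

section \<open>Comparison of sums of distinct powers of two\<close>

lemma sum_power2_inj_less:
  fixes \<gamma> :: "'a \<Rightarrow> nat"
  assumes "finite X" "inj_on \<gamma> X" "\<And>x. x \<in> X \<Longrightarrow> \<gamma> x < n"
  shows "(\<Sum>x\<in>X. 2 ^ \<gamma> x) < (2::nat) ^ n"
proof -
  have "(\<Sum>x\<in>X. 2 ^ \<gamma> x) = (\<Sum>i\<in>\<gamma> ` X. (2::nat) ^ i)"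
    using assms(2) by (simp add: sum.reindex)
  also have "\<dots> \<le> (\<Sum>i\<in>{0..<n}. 2 ^ i)"
    by (rule sum_mono2) (use assms in auto)
  also have "\<dots> < 2 ^ n" by (simp add: sum_power2)
  finally show ?thesis .
qed

text \<open>As \<open>\<gamma>\<close> is injective, the sums are binary numbers with digit sets
  \<open>\<gamma>\<close> S\<open>and\<close>\<gamma> \<open>S'\<close>. Their order is decided at
  the highest digit in which they differ, which is that of \<open>v'\<close>.\<close>

lemma sum_power2_le_last_difference:
  fixes \<gamma> :: "'a \<Rightarrow> nat"
  assumes "finite B" "inj_on \<gamma> B" "S \<subseteq> B" "S' \<subseteq> B"
    and le: "(\<Sum>x\<in>S. (2::nat) ^ \<gamma> x) \<le> (\<Sum>x\<in>S'. 2 ^ \<gamma> x)"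
    and v: "v \<in> S" "v \<notin> S'"
  shows "\<exists>v'\<in>S' - S. \<gamma> v < \<gamma> v' \<and> (\<forall>w\<in>B. \<gamma> v' < \<gamma> w \<longrightarrow> (w \<in> S \<longleftrightarrow> w \<in> S'))"
proof -
  let ?D = "(S - S') \<union> (S' - S)"
  have fin: "finite S" "finite S'" using assms finite_subset by blast+
  have "Max (\<gamma> ` ?D) \<in> \<gamma> ` ?D" using fin v by (intro Max_in) auto
  then obtain v' where v': "v' \<in> ?D" "\<gamma> v' = Max (\<gamma> ` ?D)" by (metis imageE)
  have top: "\<gamma> w \<le> \<gamma> v'" if "w \<in> ?D" for w
    unfolding v'(2) using fin that by (intro Max_ge) auto
  have inj: "w = v'" if "w \<in> ?D" "\<gamma> w = \<gamma> v'" for w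
    using inj_onD[OF assms(2) that(2)] that(1) v'(1) assms(3,4) by blast
  have "v' \<in> S' - S"
  proof (rule ccontr)
    assume "v' \<notin> S' - S"
    with v' have m: "v' \<in> S - S'" by auto
    have "\<gamma> x < \<gamma> v'" if "x \<in> S' - S" for x
      using top[of x] inj[of x] that m by fastforce
    \<comment> \<open>The power contributed by \<open>v'\<close> alone outweighs all lower digits
      together.\<close>
    hence "(\<Sum>x\<in>S' - S. 2 ^ \<gamma> x) < (2::nat) ^ \<gamma> v'"
      using fin assms by (intro sum_power2_inj_less) (auto intro: inj_on_subset)
    also have "\<dots> \<le> (\<Sum>x\<in>S - S'. 2 ^ \<gamma> x)"
      using fin m by (intro member_le_sum) auto
    finally have "(\<Sum>x\<in>S' - S. (2::nat) ^ \<gamma> x) < (\<Sum>x\<in>S - S'. 2 ^ \<gamma> x)" .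
    moreover have "(\<Sum>x\<in>S. (2::nat) ^ \<gamma> x) = (\<Sum>x\<in>S \<inter> S'. 2 ^ \<gamma> x) + (\<Sum>x\<in>S - S'. 2 ^ \<gamma> x)"
      using sum.Int_Diff[OF fin(1)] .
    moreover have "(\<Sum>x\<in>S'. (2::nat) ^ \<gamma> x) = (\<Sum>x\<in>S \<inter> S'. 2 ^ \<gamma> x) + (\<Sum>x\<in>S' - S. 2 ^ \<gamma> x)"
      using sum.Int_Diff[OF fin(2), of _ S] by (simp add: Int_commute)
    ultimately show False using le by linarith
  qed
  moreover have "\<gamma> v < \<gamma> v'"
    using top[of v] inj[of v] v calculation by fastforce
  moreover have "\<forall>w\<in>B. \<gamma> v' < \<gamma> w \<longrightarrow> (w \<in> S \<longleftrightarrow> w \<in> S')"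
    using top by fastforce
  ultimately show ?thesis by blast
qed

text \<open>Rows \<open>A\<close> of a 0-1 matrix in increasing lexicographic order, the column of
  highest rank being the most significant. The witness \<open>v'\<close> is the last column in which
  the rows differ; the agreement beyond it is what keeps a growing zigzag induced.\<close>

definition lex_sorted :: "'a set \<Rightarrow> ('a \<Rightarrow> nat) \<Rightarrow> 'a set \<Rightarrow> ('a \<Rightarrow> nat) \<Rightarrow> ('a \<Rightarrow> 'a \<Rightarrow> bool) \<Rightarrow> bool" where
  "lex_sorted A \<rho> B \<gamma> E \<longleftrightarrow> (\<forall>u\<in>A. \<forall>u'\<in>A. \<forall>v\<in>B. \<rho> u < \<rho> u' \<and> E u v \<and> \<not> E u' v \<longrightarrow>
     (\<exists>v'\<in>B. \<gamma> v < \<gamma> v' \<and> \<not> E u v' \<and> E u' v' \<and> (\<forall>w\<in>B. \<gamma> v' < \<gamma> w \<longrightarrow> E u w = E u' w)))"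

text \<open>The inner sum is the row of \<open>u\<close> read as a binary number. An optimal
  \<open>\<rho>\<close> sorts these numbers, and comparing them is comparing the rows
  lexicographically.\<close>

lemma lex_sorted_of_max:
  assumes fin: "finite A" "finite B" and inj: "inj_on \<rho> A" "\<rho> ` A \<subseteq> {..<n}" "inj_on \<gamma> B"
    and mx: "\<And>\<rho>'. inj_on \<rho>' A \<Longrightarrow> \<rho>' ` A \<subseteq> {..<n} \<Longrightarrow>
      (\<Sum>u\<in>A. (\<Sum>v\<in>{v\<in>B. E u v}. 2 ^ \<gamma> v) * 2 ^ \<rho>' u) \<le>
      (\<Sum>u\<in>A. (\<Sum>v\<in>{v\<in>B. E u v}. 2 ^ \<gamma> v) * (2::nat) ^ \<rho> u)"
  shows "lex_sorted A \<rho> B \<gamma> E"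
  unfolding lex_sorted_def
proof (intro ballI impI, elim conjE)
  fix u u' v
  assume *: "u \<in> A" "u' \<in> A" "v \<in> B" "\<rho> u < \<rho> u'" "E u v" "\<not> E u' v"
  have "(\<Sum>v\<in>{v\<in>B. E u v}. (2::nat) ^ \<gamma> v) \<le> (\<Sum>v\<in>{v\<in>B. E u' v}. 2 ^ \<gamma> v)"
    by (rule weighted_sum_max_sorted[OF fin(1) inj(1,2) mx *(1,2,4)])
  from sum_power2_le_last_difference[OF fin(2) inj(3) _ _ this, of v] *
  show "\<exists>v'\<in>B. \<gamma> v < \<gamma> v' \<and> \<not> E u v' \<and> E u' v' \<and> (\<forall>w\<in>B. \<gamma> v' < \<gamma> w \<longrightarrow> E u w = E u' w)"
    by auto
qed

lemma doubly_lexical_ordering: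
  assumes fin: "finite A" "finite B"
  shows "\<exists>\<rho> \<gamma>. inj_on \<rho> A \<and> inj_on \<gamma> B \<and> lex_sorted A \<rho> B \<gamma> E \<and> lex_sorted B \<gamma> A \<rho> (\<lambda>v u. E u v)"
proof -
  define P where "P = (\<lambda>(\<rho>, \<gamma>). inj_on \<rho> A \<and> \<rho> ` A \<subseteq> {..<card A} \<and> inj_on \<gamma> B \<and> \<gamma> ` B \<subseteq> {..<card B})"
  define W where "W = (\<lambda>(\<rho> :: 'a \<Rightarrow> nat, \<gamma> :: 'a \<Rightarrow> nat). \<Sum>u\<in>A. (\<Sum>v\<in>{v\<in>B. E u v}. 2 ^ \<gamma> v) * (2::nat) ^ \<rho> u)"
  \<comment> \<open>The weight is a sum over edges, hence also a sum over columns. One maximum of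
    \<open>W\<close> therefore sorts rows and columns at once.\<close>
  have W': "W (\<rho>, \<gamma>) = (\<Sum>v\<in>B. (\<Sum>u\<in>{u\<in>A. E u v}. 2 ^ \<rho> u) * 2 ^ \<gamma> v)" for \<rho> \<gamma>
  proof -
    have "W (\<rho>, \<gamma>) = (\<Sum>u\<in>A. \<Sum>v\<in>B. of_bool (E u v) * 2 ^ \<gamma> v * 2 ^ \<rho> u)"
      unfolding W_def prod.case
      by (intro sum.cong refl) (simp add: sum_distrib_right sum.If_cases fin of_bool_def if_distrib[of "\<lambda>x. x * _"] Int_def cong: if_cong)
    also have "\<dots> = (\<Sum>v\<in>B. \<Sum>u\<in>A. of_bool (E u v) * 2 ^ \<gamma> v * 2 ^ \<rho> u)" by (rule sum.swap)
    also have "\<dots> = (\<Sum>v\<in>B. (\<Sum>u\<in>{u\<in>A. E u v}. 2 ^ \<rho> u) * 2 ^ \<gamma> v)"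
      by (intro sum.cong refl) (simp add: sum_distrib_right sum.If_cases fin of_bool_def if_distrib[of "\<lambda>x. _ * x"] if_distrib[of "\<lambda>x. x * _"] Int_def sum_distrib_left mult_ac cong: if_cong)
    finally show ?thesis .
  qed
  obtain \<rho>0 where "bij_betw \<rho>0 A {0..<card A}" using ex_bij_betw_finite_nat fin by blast
  moreover obtain \<gamma>0 where "bij_betw \<gamma>0 B {0..<card B}" using ex_bij_betw_finite_nat fin by blast
  ultimately have P0: "P (\<rho>0, \<gamma>0)" by (auto simp: P_def bij_betw_def)
  \<comment> \<open>Ranks bounded by the cardinalities bound the weight, so that a maximum
    exists.\<close>
  have bd: "W x < Suc (card A * (2 ^ card B * 2 ^ card A))" if "P x" for x
  proof -
    obtain \<rho> \<gamma> where x: "x = (\<rho>, \<gamma>)" by (cases x)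
    have "W x \<le> (\<Sum>u\<in>A. 2 ^ card B * 2 ^ card A)"
      unfolding W_def x prod.case
    proof (intro sum_mono mult_mono)
      fix u assume "u \<in> A"
      show "(\<Sum>v\<in>{v\<in>B. E u v}. 2 ^ \<gamma> v) \<le> (2::nat) ^ card B"
        using that fin unfolding x P_def
        by (intro less_imp_le sum_power2_inj_less) (auto intro: inj_on_subset)
      show "(2::nat) ^ \<rho> u \<le> 2 ^ card A"
        using that \<open>u \<in> A\<close> unfolding x P_def by (intro power_increasing) auto
    qed auto
    thus ?thesis by simp
  qed
  obtain \<rho> \<gamma> where mx: "P (\<rho>, \<gamma>)" "\<And>y. P y \<Longrightarrow> W y \<le> W (\<rho>, \<gamma>)"
    using ex_has_greatest_nat[of P "(\<rho>0, \<gamma>0)" W, OF P0] bd by (metis surj_pair)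
  have a: "inj_on \<rho> A" "\<rho> ` A \<subseteq> {..<card A}" "inj_on \<gamma> B" "\<gamma> ` B \<subseteq> {..<card B}"
    using mx(1) by (auto simp: P_def)
  have "lex_sorted A \<rho> B \<gamma> E"
  proof (rule lex_sorted_of_max[OF fin a(1,2,3)])
    fix \<rho>' assume "inj_on \<rho>' A" "\<rho>' ` A \<subseteq> {..<card A}"
    hence "W (\<rho>', \<gamma>) \<le> W (\<rho>, \<gamma>)" using a by (intro mx(2)) (auto simp: P_def)
    thus "(\<Sum>u\<in>A. (\<Sum>v\<in>{v\<in>B. E u v}. 2 ^ \<gamma> v) * 2 ^ \<rho>' u) \<le>
      (\<Sum>u\<in>A. (\<Sum>v\<in>{v\<in>B. E u v}. 2 ^ \<gamma> v) * (2::nat) ^ \<rho> u)" by (simp add: W_def)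
  qed
  moreover have "lex_sorted B \<gamma> A \<rho> (\<lambda>v u. E u v)"
  proof (rule lex_sorted_of_max[OF fin(2,1) a(3,4,1)])
    fix \<gamma>' assume "inj_on \<gamma>' B" "\<gamma>' ` B \<subseteq> {..<card B}"
    hence "W (\<rho>, \<gamma>') \<le> W (\<rho>, \<gamma>)" using a by (intro mx(2)) (auto simp: P_def)
    thus "(\<Sum>v\<in>B. (\<Sum>u\<in>{u\<in>A. E u v}. 2 ^ \<rho> u) * 2 ^ \<gamma>' v) \<le>
      (\<Sum>v\<in>B. (\<Sum>u\<in>{u\<in>A. E u v}. 2 ^ \<rho> u) * (2::nat) ^ \<gamma> v)" by (simp add: W')
  qed
  ultimately show ?thesis using a by blast
qed

subsection \<open>Bisimplicial edges\<close>

text \<open>The last clause is the invariant of the construction: two consecutive columns agree on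
  all rows beyond the next but one, and likewise for rows. It prevents chords between a new vertex
  and old ones.\<close>

definition bipartite_zigzag :: "'a set \<Rightarrow> ('a \<Rightarrow> nat) \<Rightarrow> 'a set \<Rightarrow> ('a \<Rightarrow> nat) \<Rightarrow> ('a \<Rightarrow> 'a \<Rightarrow> bool) \<Rightarrow>
    nat \<Rightarrow> (nat \<Rightarrow> 'a) \<Rightarrow> (nat \<Rightarrow> 'a) \<Rightarrow> bool" where
  "bipartite_zigzag A \<rho> B \<gamma> E n r c \<longleftrightarrow>
     (\<forall>i\<le>n. r i \<in> A \<and> c i \<in> B) \<and>
     (\<forall>i<n. \<rho> (r i) < \<rho> (r (Suc i)) \<and> \<gamma> (c i) < \<gamma> (c (Suc i))) \<and>
     (\<forall>i\<le>n. \<forall>j\<le>n. E (r i) (c j) \<longleftrightarrow> i = Suc j \<or> j = Suc i \<or> i = 0 \<and> j = 0) \<and>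
     (\<forall>i. i + 2 \<le> n \<longrightarrow> (\<forall>w\<in>A. \<rho> (r (i + 2)) < \<rho> w \<longrightarrow> E w (c i) = E w (c (Suc i))) \<and>
                       (\<forall>w\<in>B. \<gamma> (c (i + 2)) < \<gamma> w \<longrightarrow> E (r i) w = E (r (Suc i)) w))"

lemma rank_less_of_steps:
  fixes f :: "nat \<Rightarrow> nat"
  assumes "\<forall>i<n. f i < f (Suc i)" "i < j" "j \<le> n"
  shows "f i < f j"
  using assms(2,3)
proof (induction j)
  case (Suc j)
  have "f j < f (Suc j)" using assms(1) Suc.prems by auto
  thus ?case using Suc by (cases "i = j") auto
qed auto

text \<open>The zigzag is the induced path ..., c 3, r 2, c 1, r 0, c 0, r 1, c 2, ...; its two ends are r m
  and c m, and it closes up to a hole once these are adjacent.\<close>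

lemma closed_zigzag_hole:
  assumes m: "2 \<le> m" and AB: "A \<inter> B = {}" "A \<union> B \<subseteq> V"
    and sym: "\<And>u v. E u v = E v u"
    and stable: "\<And>u v. u \<in> A \<Longrightarrow> v \<in> A \<Longrightarrow> \<not> E u v" "\<And>u v. u \<in> B \<Longrightarrow> v \<in> B \<Longrightarrow> \<not> E u v"
    and rc: "\<And>i. i \<le> m \<Longrightarrow> r i \<in> A" "\<And>i. i \<le> m \<Longrightarrow> c i \<in> B" "inj_on r {..m}" "inj_on c {..m}"
    and adj: "\<And>i j. i \<le> m \<Longrightarrow> j \<le> m \<Longrightarrow>
      E (r i) (c j) \<longleftrightarrow> i = Suc j \<or> j = Suc i \<or> i = 0 \<and> j = 0 \<or> i = m \<and> j = m"
  shows "\<not> hole_free V E"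
proof -
  \<comment> \<open>The indices up to \<open>m\<close> follow one arm inwards to \<open>r 0\<close>;
    the others follow the second arm from \<open>c 0\<close> outwards. The closing edge joins the
    last vertex to \<open>h 0\<close>.\<close>
  define h where "h i = (if i \<le> m then (if even (m - i) then r (m - i) else c (m - i))
     else (if even (i - Suc m) then c (i - Suc m) else r (i - Suc m)))" for i
  let ?k = "2 * m + 2"
  have k5: "5 \<le> ?k" using m by simp
  have mem: "h i \<in> V" if "i < ?k" for i
    using that rc(1,2) AB(2) by (auto simp: h_def)
  have rc_ne: "r i \<noteq> c j" if "i \<le> m" "j \<le> m" for i j using rc(1,2) that AB(1) by (metis disjoint_iff)
  have r_eq: "r i = r j \<longleftrightarrow> i = j" and c_eq: "c i = c j \<longleftrightarrow> i = j" if "i \<le> m" "j \<le> m" for i j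
    using rc(3,4) that by (auto simp: inj_on_def)
  have non: "\<not> E (r i) (r j)" "\<not> E (c i) (c j)" if "i \<le> m" "j \<le> m" for i j
    using stable rc(1,2) that by auto
  have adj': "E (c i) (r j) \<longleftrightarrow> i = Suc j \<or> j = Suc i \<or> i = 0 \<and> j = 0 \<or> i = m \<and> j = m"
    if "i \<le> m" "j \<le> m" for i j
    using adj[of j i] that sym[of "c i" "r j"] by blast
  have cr_ne: "c i \<noteq> r j" if "i \<le> m" "j \<le> m" for i j using rc_ne[OF that(2,1)] by simp
  note facts = non adj adj' rc_ne cr_ne r_eq c_eq
  have h_less: "h i \<noteq> h j \<and> (E (h i) (h j) \<longleftrightarrow> cyc_adj_idx ?k i j)" if "i < j" "j < ?k" for i j
  proof -
    \<comment> \<open>Both vertices on the first arm, one on each arm, or both on the second. In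
      each case \<open>a\<close> and \<open>b\<close> count the distance from the centre, and their
      parities tell rows from columns.\<close>
    consider "j \<le> m" | "i \<le> m" "m < j" | "m < i" using that by linarith
    thus ?thesis
    proof cases
      case 1
      define a b where "a = m - i" and "b = m - j"
      have ab: "i = m - a" "j = m - b" "a \<le> m" "b < a" using 1 that by (auto simp: a_def b_def)
      have "cyc_adj_idx ?k i j \<longleftrightarrow> a = Suc b" using ab that 1 by (auto simp: cyc_adj_idx_def)
      moreover have "h i = (if even a then r a else c a)" "h j = (if even b then r b else c b)"
        using 1 that by (auto simp: h_def a_def b_def)
      moreover have "even a = even b \<Longrightarrow> a \<noteq> Suc b" by auto
      ultimately show ?thesis
        using ab facts[of a b] by (cases "even a"; cases "even b") simp_all
    next
      case 2
      define a b where "a = m - i" and "b = j - Suc m"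
      have ab: "i = m - a" "j = Suc m + b" "a \<le> m" "b \<le> m" using 2 that by (auto simp: a_def b_def)
      have "cyc_adj_idx ?k i j \<longleftrightarrow> a = 0 \<and> b = 0 \<or> a = m \<and> b = m" using ab that 2 by (auto simp: cyc_adj_idx_def)
      moreover have "h i = (if even a then r a else c a)" "h j = (if even b then c b else r b)"
        using 2 that by (auto simp: h_def a_def b_def)
      moreover have "even a = even b \<Longrightarrow> a \<noteq> Suc b \<and> b \<noteq> Suc a" 
          "even a \<noteq> even b \<Longrightarrow> a \<noteq> b \<and> \<not> (a = 0 \<and> b = 0) \<and> \<not> (a = m \<and> b = m)" by (auto simp: odd_pos)
      ultimately show ?thesis
        using ab facts[of a b] by (cases "even a"; cases "even b") simp_all
    next
      case 3
      define a b where "a = i - Suc m" and "b = j - Suc m"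
      have ab: "i = Suc m + a" "j = Suc m + b" "b \<le> m" "a < b" using 3 that by (auto simp: a_def b_def)
      have "cyc_adj_idx ?k i j \<longleftrightarrow> b = Suc a" using ab that 3 by (auto simp: cyc_adj_idx_def)
      moreover have "h i = (if even a then c a else r a)" "h j = (if even b then c b else r b)"
        using 3 that by (auto simp: h_def a_def b_def)
      moreover have "even a = even b \<Longrightarrow> b \<noteq> Suc a" by auto
      ultimately show ?thesis
        using ab facts[of a b] by (cases "even a"; cases "even b") simp_all
    qed
  qed
  have "inj_on h {0..<?k}"
    using h_less by (intro linorder_inj_onI') auto
  moreover have "h ` {0..<?k} \<subseteq> V" using mem by auto
  moreover have "E (h i) (h j) \<longleftrightarrow> cyc_adj_idx ?k i j" if "i < ?k" "j < ?k" "i \<noteq> j" for i j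
  proof -
    have "cyc_adj_idx ?k j i = cyc_adj_idx ?k i j" by (auto simp: cyc_adj_idx_def)
    thus ?thesis using h_less[of i j] h_less[of j i] that sym by (metis linorder_neqE_nat)
  qed
  ultimately show ?thesis using k5 unfolding hole_free_def by blast
qed

text \<open>Row \<open>u\<close> lies beyond every \<open>r (i + 2)\<close> with
  \<open>i < j\<close>, where columns \<open>c i\<close> and \<open>c (Suc i)\<close> agree. The
  non-adjacency to \<open>c j\<close> thus passes down to all earlier columns.\<close>

lemma zigzag_new_row_nonadjacent:
  assumes z: "bipartite_zigzag A \<rho> B \<gamma> E n r c" and u: "u \<in> A" "\<rho> (r n) < \<rho> u"
    and last: "Suc j = n" "\<not> E u (c j)" and i: "i \<le> j"
  shows "\<not> E u (c i)"
  using i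
proof (induction i rule: inc_induct)
  case base thus ?case by (fact last)
next
  case (step i)
  have "\<rho> (r (i + 2)) \<le> \<rho> (r n)"
    using rank_less_of_steps[of n "\<lambda>i. \<rho> (r i)" "i + 2" n] z step last
    by (cases "i + 2 = n") (auto simp: bipartite_zigzag_def)
  hence "E u (c i) = E u (c (Suc i))" using z step last u by (simp add: bipartite_zigzag_def)
  with step show ?case by simp
qed

text \<open>Transposing the matrix lets the construction of a new row serve for new columns as
  well.\<close>

lemma bipartite_zigzag_swap:
  "bipartite_zigzag A \<rho> B \<gamma> E n r c \<longleftrightarrow> bipartite_zigzag B \<gamma> A \<rho> (\<lambda>v u. E u v) n c r"
  unfolding bipartite_zigzag_def by auto

text \<open>Row \<open>r n\<close> has a one in column \<open>c j\<close> and a zero in the later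
  column \<open>c n\<close>. Lexical order of the columns forces a later row \<open>u\<close> with
  the opposite pattern, and \<open>u\<close> is taken at the last difference.\<close>

lemma zigzag_next_row:
  assumes lex: "lex_sorted B \<gamma> A \<rho> (\<lambda>v u. E u v)" and z: "bipartite_zigzag A \<rho> B \<gamma> E n r c" and n: "Suc j = n"
  obtains u where "u \<in> A" "\<rho> (r n) < \<rho> u" "E u (c n)" "\<And>i. i < n \<Longrightarrow> \<not> E u (c i)"
    "\<forall>w\<in>A. \<rho> u < \<rho> w \<longrightarrow> E w (c j) = E w (c n)"
proof -
  have "c j \<in> B" "c n \<in> B" "\<gamma> (c j) < \<gamma> (c n)" "r n \<in> A" "E (r n) (c j)" "\<not> E (r n) (c n)"
    using z n by (auto simp: bipartite_zigzag_def)
  with lex obtain u where u: "u \<in> A" "\<rho> (r n) < \<rho> u" "\<not> E u (c j)" "E u (c n)"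
      "\<forall>w\<in>A. \<rho> u < \<rho> w \<longrightarrow> E w (c j) = E w (c n)"
    unfolding lex_sorted_def by blast
  have "\<not> E u (c i)" if "i < n" for i
    using zigzag_new_row_nonadjacent[OF z u(1,2) n u(3), of i] that n by auto
  with that u show ?thesis by blast
qed

text \<open>The new row \<open>u\<close> and new column \<open>v\<close> attach to the two ends
  only. Were they adjacent to each other, the zigzag would close up to a hole; so it grows by one
  vertex at each end.\<close>

lemma zigzag_extend:
  assumes lex: "lex_sorted A \<rho> B \<gamma> E" "lex_sorted B \<gamma> A \<rho> (\<lambda>v u. E u v)"
    and hf: "hole_free V E" and AB: "A \<inter> B = {}" "A \<union> B \<subseteq> V"
    and sym: "\<And>u v. E u v = E v u"
    and stable: "\<And>u v. u \<in> A \<Longrightarrow> v \<in> A \<Longrightarrow> \<not> E u v" "\<And>u v. u \<in> B \<Longrightarrow> v \<in> B \<Longrightarrow> \<not> E u v"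
    and z: "bipartite_zigzag A \<rho> B \<gamma> E n r c" and n: "1 \<le> n"
  shows "\<exists>r' c'. bipartite_zigzag A \<rho> B \<gamma> E (Suc n) r' c'"
proof -
  obtain j where j: "Suc j = n" using n by (metis One_nat_def Suc_le_D)
  obtain u where u: "u \<in> A" "\<rho> (r n) < \<rho> u" "E u (c n)" "\<And>i. i < n \<Longrightarrow> \<not> E u (c i)"
      "\<forall>w\<in>A. \<rho> u < \<rho> w \<longrightarrow> E w (c j) = E w (c n)"
    using zigzag_next_row[OF lex(2) z j] by blast
  have z': "bipartite_zigzag B \<gamma> A \<rho> (\<lambda>v u. E u v) n c r" using z bipartite_zigzag_swap by blast
  obtain v where v: "v \<in> B" "\<gamma> (c n) < \<gamma> v" "E (r n) v" "\<And>i. i < n \<Longrightarrow> \<not> E (r i) v"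
      "\<forall>w\<in>B. \<gamma> v < \<gamma> w \<longrightarrow> E (r j) w = E (r n) w"
    using zigzag_next_row[of A \<rho> B \<gamma> "\<lambda>v u. E u v", OF _ z' j] lex(1) by auto
  define r' c' where "r' = r(Suc n := u)" and "c' = c(Suc n := v)"
  have mem: "r' i \<in> A" "c' i \<in> B" if "i \<le> Suc n" for i
    using that z u v by (auto simp: r'_def c'_def bipartite_zigzag_def le_Suc_eq)
  have steps: "\<forall>i<Suc n. \<rho> (r' i) < \<rho> (r' (Suc i))" "\<forall>i<Suc n. \<gamma> (c' i) < \<gamma> (c' (Suc i))"
    using z u v by (auto simp: r'_def c'_def bipartite_zigzag_def less_Suc_eq)
  have inj: "inj_on r' {..Suc n}" "inj_on c' {..Suc n}"
    using rank_less_of_steps[of "Suc n" "\<lambda>i. \<rho> (r' i)", OF steps(1)]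
      rank_less_of_steps[of "Suc n" "\<lambda>i. \<gamma> (c' i)", OF steps(2)]
    by (auto intro!: linorder_inj_onI') (metis less_irrefl)+
  have adj: "E (r' i) (c' k) \<longleftrightarrow> i = Suc k \<or> k = Suc i \<or> i = 0 \<and> k = 0"
    if ik: "i \<le> Suc n" "k \<le> Suc n" "\<not> (i = Suc n \<and> k = Suc n)" for i k
  proof -
    consider "i \<le> n" "k \<le> n" | "i = Suc n" "k < n" | "i = Suc n" "k = n" | "k = Suc n" "i < n" | "k = Suc n" "i = n"
      using ik by linarith
    thus ?thesis
      by cases (use z u(3,4) v(3,4) in \<open>auto simp: r'_def c'_def bipartite_zigzag_def\<close>)
  qed
  have "\<not> E u v"
  proof
    assume "E u v"
    have "E (r' i) (c' k) \<longleftrightarrow> i = Suc k \<or> k = Suc i \<or> i = 0 \<and> k = 0 \<or> i = Suc n \<and> k = Suc n"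
      if "i \<le> Suc n" "k \<le> Suc n" for i k
      using adj[of i k] that \<open>E u v\<close> by (cases "i = Suc n \<and> k = Suc n") (auto simp: r'_def c'_def)
    \<comment> \<open>Since \<open>n\<close> is at least 1, the closed zigzag has parameter
      \<open>Suc n\<close> at least 2, hence at least six vertices.\<close>
    from closed_zigzag_hole[OF _ AB sym stable mem inj this] n hf show False by auto
  qed
  hence adj': "E (r' i) (c' k) \<longleftrightarrow> i = Suc k \<or> k = Suc i \<or> i = 0 \<and> k = 0"
    if "i \<le> Suc n" "k \<le> Suc n" for i k
    using adj[of i k] that by (cases "i = Suc n \<and> k = Suc n") (auto simp: r'_def c'_def)
  have last: "(\<forall>w\<in>A. \<rho> (r' (i + 2)) < \<rho> w \<longrightarrow> E w (c' i) = E w (c' (Suc i))) \<and>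
      (\<forall>w\<in>B. \<gamma> (c' (i + 2)) < \<gamma> w \<longrightarrow> E (r' i) w = E (r' (Suc i)) w)" if "i + 2 \<le> Suc n" for i
  proof (cases "i = j")
    case True
    \<comment> \<open>The only new instance of the invariant is the choice of \<open>u\<close> and
      \<open>v\<close> at the last difference.\<close>
    thus ?thesis using u(5) v(5) j by (auto simp: r'_def c'_def)
  next
    case False
    hence "i + 2 \<le> n" using that j by simp
    thus ?thesis using z by (auto simp: r'_def c'_def bipartite_zigzag_def)
  qed
  have "bipartite_zigzag A \<rho> B \<gamma> E (Suc n) r' c'"
    unfolding bipartite_zigzag_def using mem steps adj' last by blast
  thus ?thesis by blast
qed

text \<open>In a doubly lexical ordering without Gamma configuration, the first one of the first
  nonzero row is bisimplicial, as all competing rows and columns come later.\<close>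

lemma hole_free_bipartite_bisimplicial_edge:
  assumes fin: "finite V" and hf: "hole_free V E" and AB: "A \<inter> B = {}" "A \<union> B = V"
    and sym: "\<And>u v. E u v = E v u"
    and stable: "\<And>u v. u \<in> A \<Longrightarrow> v \<in> A \<Longrightarrow> \<not> E u v" "\<And>u v. u \<in> B \<Longrightarrow> v \<in> B \<Longrightarrow> \<not> E u v"
    and edge: "u0 \<in> A" "v0 \<in> B" "E u0 v0"
  shows "\<exists>u\<in>A. \<exists>v\<in>B. E u v \<and> (\<forall>u'\<in>A. \<forall>v'\<in>B. E u v' \<and> E u' v \<longrightarrow> E u' v')"
proof -
  have finAB: "finite A" "finite B" using fin AB(2) by auto
  obtain \<rho> \<gamma> where inj: "inj_on \<rho> A" "inj_on \<gamma> B"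
    and lex: "lex_sorted A \<rho> B \<gamma> E" "lex_sorted B \<gamma> A \<rho> (\<lambda>v u. E u v)"
    using doubly_lexical_ordering[OF finAB] by blast
  have gamma_free: "E u' v'"
    if "u \<in> A" "u' \<in> A" "v \<in> B" "v' \<in> B" "\<rho> u < \<rho> u'" "\<gamma> v < \<gamma> v'" "E u v" "E u v'" "E u' v" for u u' v v'
  proof (rule ccontr)
    assume "\<not> E u' v'"
    have "\<exists>r c. bipartite_zigzag A \<rho> B \<gamma> E (Suc n) r c" for n
    proof (induction n)
      case 0
      \<comment> \<open>A Gamma configuration is itself the smallest zigzag with a step.\<close>
      have "bipartite_zigzag A \<rho> B \<gamma> E (Suc 0) (\<lambda>i. if i = 0 then u else u') (\<lambda>i. if i = 0 then v else v')"
        using that \<open>\<not> E u' v'\<close> by (auto simp: bipartite_zigzag_def le_Suc_eq)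
      thus ?case by blast
    next
      case (Suc n)
      thus ?case using zigzag_extend[OF lex hf AB(1) _ sym stable] AB(2) by fastforce
    qed
    \<comment> \<open>This zigzag would need \<open>card A + 2\<close> distinct rows.\<close>
    then obtain r c where z: "bipartite_zigzag A \<rho> B \<gamma> E (Suc (card A)) r c" by blast
    have "r ` {..Suc (card A)} \<subseteq> A" using z by (auto simp: bipartite_zigzag_def)
    moreover have "inj_on r {..Suc (card A)}"
    proof (rule linorder_inj_onI')
      fix i j assume "i \<in> {..Suc (card A)}" "j \<in> {..Suc (card A)}" "i < j"
      hence "\<rho> (r i) < \<rho> (r j)"
        using rank_less_of_steps[of "Suc (card A)" "\<lambda>i. \<rho> (r i)" i j] z by (auto simp: bipartite_zigzag_def)
      thus "r i \<noteq> r j" by auto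
    qed
    ultimately have "card {..Suc (card A)} \<le> card A" using finAB(1) by (intro card_inj_on_le)
    thus False by simp
  qed
  obtain u where u: "u \<in> A" "\<exists>v\<in>B. E u v" and umin: "\<And>w. w \<in> A \<Longrightarrow> \<exists>v\<in>B. E w v \<Longrightarrow> \<rho> u \<le> \<rho> w"
    using ex_has_least_nat[of "\<lambda>u. u \<in> A \<and> (\<exists>v\<in>B. E u v)" u0 \<rho>] edge by blast
  obtain v where v: "v \<in> B" "E u v" and vmin: "\<And>w. w \<in> B \<Longrightarrow> E u w \<Longrightarrow> \<gamma> v \<le> \<gamma> w"
    using ex_has_least_nat[of "\<lambda>v. v \<in> B \<and> E u v" _ \<gamma>] u by blast
  have "E u' v'" if "u' \<in> A" "v' \<in> B" "E u v'" "E u' v" for u' v'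
  proof (cases "u' = u \<or> v' = v")
    case False
    hence "\<rho> u \<noteq> \<rho> u'" "\<gamma> v \<noteq> \<gamma> v'" using inj that u v by (auto simp: inj_on_def)
    moreover have "\<rho> u \<le> \<rho> u'" "\<gamma> v \<le> \<gamma> v'" using umin vmin that v by auto
    ultimately show ?thesis using gamma_free[of u u' v v'] that u v by auto
  qed (use that in auto)
  with u v show ?thesis by blast
qed

subsection \<open>Longest induced paths in claw-free graphs\<close>

definition induced_path :: "'a set \<Rightarrow> ('a \<Rightarrow> 'a \<Rightarrow> bool) \<Rightarrow> 'a list \<Rightarrow> bool" where
  "induced_path V E xs \<longleftrightarrow> distinct xs \<and> set xs \<subseteq> V \<and>
     (\<forall>j<length xs. \<forall>i<j. E (xs ! i) (xs ! j) \<longleftrightarrow> j = i + 1)"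

text \<open>By maximality \<open>p\<close> cannot be prepended, so it sees a later vertex
  \<open>xs ! i\<close> with \<open>i\<close> at least 2. For the least such \<open>i\<close>, the
  vertices \<open>p, xs ! 0, ..., xs ! i\<close> form an induced cycle of length
  \<open>i + 2\<close>, which is no hole only if \<open>i = 2\<close>.\<close>

lemma longest_induced_path_end:
  assumes sym: "\<And>u v. E u v = E v u" and irr: "\<And>u. \<not> E u u" and hf: "hole_free V E"
    and xs: "induced_path V E xs" "2 \<le> length xs"
    and mx: "\<And>ys. induced_path V E ys \<Longrightarrow> length ys \<le> length xs"
    and p: "p \<in> V" "E p (xs ! 0)" "p \<noteq> xs ! 1" "\<not> E p (xs ! 1)"
  shows "3 \<le> length xs \<and> E p (xs ! 2)"
proof -
  have pth: "distinct xs" "set xs \<subseteq> V" "\<And>i j. i < j \<Longrightarrow> j < length xs \<Longrightarrow> E (xs ! i) (xs ! j) \<longleftrightarrow> j = i + 1"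
    using xs(1) by (auto simp: induced_path_def)
  have nin: "p \<notin> set xs"
  proof
    assume "p \<in> set xs"
    then obtain i where i: "i < length xs" "p = xs ! i" by (auto simp: in_set_conv_nth)
    with p irr have "i \<noteq> 0" by metis
    with pth(3)[of 0 i] i p sym have "i = 1" by auto
    with i p show False by simp
  qed
  have "\<exists>i. i < length xs \<and> 2 \<le> i \<and> E p (xs ! i)"
  proof (rule ccontr)
    assume no: "\<nexists>i. i < length xs \<and> 2 \<le> i \<and> E p (xs ! i)"
    have "E p (xs ! i) \<longleftrightarrow> i = 0" if "i < length xs" for i
      using no p that by (metis One_nat_def Suc_1 Suc_leI le_neq_implies_less less_one linorder_not_le not_less_eq_eq)
    hence "induced_path V E (p # xs)"
      using pth nin p unfolding induced_path_def
      by (auto simp: nth_Cons split: nat.splits)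
    from mx[OF this] show False by simp
  qed
  then obtain i where i: "i < length xs" "2 \<le> i" "E p (xs ! i)"
    and least: "\<And>j. j < i \<Longrightarrow> 2 \<le> j \<Longrightarrow> \<not> E p (xs ! j)"
    using exists_least_iff[of "\<lambda>i. i < length xs \<and> 2 \<le> i \<and> E p (xs ! i)"]
    by (metis order.strict_trans)
  have "i = 2"
  proof (rule ccontr)
    assume "i \<noteq> 2"
    with i have i3: "3 \<le> i" by simp
    let ?h = "\<lambda>k. (p # xs) ! k"
    have pe: "E p (xs ! j) \<longleftrightarrow> j = 0 \<or> j = i" if "j \<le> i" for j
      using least[of j] that p i by (cases "j = 0"; cases "j = 1"; cases "j = i") auto
    have half: "E (?h a) (?h b) \<longleftrightarrow> cyc_adj_idx (i + 2) a b" if "a < b" "b < i + 2" for a b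
      using that i pe[of "b - 1"] pth(3)[of "a - 1" "b - 1"]
      by (cases a; cases b) (auto simp: cyc_adj_idx_def)
    have "E (?h a) (?h b) \<longleftrightarrow> cyc_adj_idx (i + 2) a b" if "a < i + 2" "b < i + 2" "a \<noteq> b" for a b
    proof (cases "a < b")
      case True thus ?thesis using half that by blast
    next
      case False
      hence "E (?h b) (?h a) \<longleftrightarrow> cyc_adj_idx (i + 2) b a" using half that by simp
      moreover have "cyc_adj_idx (i + 2) b a = cyc_adj_idx (i + 2) a b" by (auto simp: cyc_adj_idx_def)
      ultimately show ?thesis using sym by blast
    qed
    moreover have "inj_on ?h {0..<i + 2}"
      using pth(1) nin i(1) by (intro inj_on_nth) auto
    moreover have "?h ` {0..<i + 2} \<subseteq> V"
    proof
      fix y assume "y \<in> ?h ` {0..<i + 2}"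
      hence "y \<in> set (p # xs)" using i(1) by (auto simp del: list.set nth_Cons_Suc intro!: nth_mem)
      thus "y \<in> V" using pth(2) p(1) by auto
    qed
    moreover have "5 \<le> i + 2" using i3 by simp
    ultimately show False using hf unfolding hole_free_def by blast
  qed
  with i show ?thesis by auto
qed

text \<open>Claw-freeness ensures that exchanging the first vertices of the path keeps it induced:
  \<open>p\<close> takes over the role of \<open>xs ! 2\<close> towards the rest. The end lemma then
  applies to \<open>q\<close> and the new path.\<close>

lemma claw_free_edge_no_central_P4:
  assumes fin: "finite V" and sym: "\<And>u v. E u v = E v u" and irr: "\<And>u. \<not> E u u" and hf: "hole_free V E"
    and claw: "\<And>y a b c. \<lbrakk>y \<in> V; a \<in> V; b \<in> V; c \<in> V; a \<noteq> b; a \<noteq> c; b \<noteq> c; E y a; E y b; E y c\<rbrakk>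
      \<Longrightarrow> E a b \<or> E a c \<or> E b c"
    and edge: "u0 \<in> V" "v0 \<in> V" "E u0 v0"
  shows "\<exists>u\<in>V. \<exists>v\<in>V. E u v \<and> (\<forall>p\<in>V. \<forall>q\<in>V. E p u \<and> p \<noteq> v \<and> \<not> E p v \<and> E v q \<and> q \<noteq> u \<and> \<not> E q u \<and> p \<noteq> q \<longrightarrow> E p q)"
proof -
  let ?P = "\<lambda>xs. induced_path V E xs"
  have "?P [u0, v0]"
    using edge irr by (auto simp: induced_path_def less_Suc_eq)
  moreover have "\<forall>xs. ?P xs \<longrightarrow> length xs < Suc (card V)"
    using fin by (auto simp: induced_path_def less_Suc_eq_le) (metis card_mono distinct_card)
  ultimately obtain xs where xs: "?P xs" and mx: "\<And>ys. ?P ys \<Longrightarrow> length ys \<le> length xs"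
    using ex_has_greatest_nat[of ?P _ length] by blast
  have l2: "2 \<le> length xs" using mx[OF \<open>?P [u0, v0]\<close>] by simp
  have pth: "distinct xs" "set xs \<subseteq> V" "\<And>i j. i < j \<Longrightarrow> j < length xs \<Longrightarrow> E (xs ! i) (xs ! j) \<longleftrightarrow> j = i + 1"
    using xs by (auto simp: induced_path_def)
  have inV: "xs ! i \<in> V" if "i < length xs" for i using that pth(2) by auto
  define a b where "a = xs ! 0" and "b = xs ! 1"
  have ab: "a \<in> V" "b \<in> V" "E a b"
    using inV[of 0] inV[of 1] pth(3)[of 0 1] l2 unfolding a_def b_def by force+
  have "E p q"
    if "p \<in> V" "q \<in> V" "E p a" "p \<noteq> b" "\<not> E p b" "E b q" "q \<noteq> a" "\<not> E q a" "p \<noteq> q" for p q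
  proof -
    have l3: "3 \<le> length xs" and p2: "E p (xs ! 2)"
      using longest_induced_path_end[OF sym irr hf xs l2 mx that(1)] that unfolding a_def b_def by metis+
    have l0: "0 < length xs" "1 < length xs" "2 < length xs" "xs \<noteq> []" using l3 by auto
    have pnin: "p \<notin> set xs"
    proof
      assume "p \<in> set xs"
      then obtain i where i: "i < length xs" "p = xs ! i" by (auto simp: in_set_conv_nth)
      with that irr have "i \<noteq> 0" by (metis a_def)
      with pth(3)[of 0 i] i that sym have "i = 1" by (auto simp: a_def)
      with i that show False by (simp add: b_def)
    qed
    have pne: "p \<noteq> xs ! i" if "i < length xs" for i using pnin that nth_mem by metis
    \<comment> \<open>Otherwise \<open>xs ! 2\<close> is the centre of a claw with leaves
      \<open>xs ! 1\<close>, \<open>p\<close>, \<open>xs ! 3\<close>.\<close>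
    have p3: "E p (xs ! 3)" if "3 < length xs"
    proof -
      have "E (xs ! 1) p \<or> E (xs ! 1) (xs ! 3) \<or> E p (xs ! 3)"
      proof (rule claw[of "xs ! 2"])
        show "E (xs ! 2) (xs ! 1)" "E (xs ! 2) p" "E (xs ! 2) (xs ! 3)"
          using pth(3)[of 1 2] pth(3)[of 2 3] p2 that sym by auto
        show "xs ! 1 \<noteq> p" "xs ! 1 \<noteq> xs ! 3" "p \<noteq> xs ! 3"
          using pne[of 1] pne[of 3] that pth(1) by (auto simp: nth_eq_iff_index_eq)
      qed (use inV that \<open>p \<in> V\<close> in auto)
      thus ?thesis using \<open>\<not> E p b\<close> sym pth(3)[of 1 3] that unfolding b_def by auto
    qed
    \<comment> \<open>Such an edge would make \<open>p\<close> the centre of a claw with leaves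
      \<open>xs ! 0\<close>, \<open>xs ! 2\<close>, \<open>xs ! j\<close>.\<close>
    have pj: "\<not> E p (xs ! j)" if "4 \<le> j" "j < length xs" for j
    proof
      assume "E p (xs ! j)"
      have "E (xs ! 0) (xs ! 2) \<or> E (xs ! 0) (xs ! j) \<or> E (xs ! 2) (xs ! j)"
      proof (rule claw[of p])
        show "E p (xs ! 0)" using \<open>E p a\<close> by (simp add: a_def)
        show "xs ! 0 \<noteq> xs ! 2" "xs ! 0 \<noteq> xs ! j" "xs ! 2 \<noteq> xs ! j"
          using that l0 pth(1) by (auto simp: nth_eq_iff_index_eq)
        show "xs ! 0 \<in> V" "xs ! 2 \<in> V" "xs ! j \<in> V" using that l0 by (auto intro!: inV)
      qed (use \<open>p \<in> V\<close> p2 \<open>E p (xs ! j)\<close> in blast)+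
      thus False using pth(3)[of 0 2] pth(3)[of 0 j] pth(3)[of 2 j] l0 that by auto
    qed
    define ys where "ys = xs[0 := b, 1 := a, 2 := p]"
    have len: "length ys = length xs" by (simp add: ys_def)
    have nth: "ys ! i = (if i = 0 then b else if i = 1 then a else if i = 2 then p else xs ! i)"
      if "i < length xs" for i using that by (auto simp: ys_def nth_list_update)
    have "?P ys"
      unfolding induced_path_def len
    proof (intro conjI allI impI)
      show "distinct ys"
        unfolding distinct_conv_nth len
      proof (intro allI impI)
        fix i j assume "i < length xs" "j < length xs" "i \<noteq> j"
        thus "ys ! i \<noteq> ys ! j" using pne[of i] pne[of j] pne[of 0] pne[of 1] pth(1) l0
          by (auto simp: nth a_def b_def nth_eq_iff_index_eq)
      qed
      show "set ys \<subseteq> V"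
      proof
        fix y assume "y \<in> set ys"
        then obtain i where "i < length xs" "y = ys ! i" by (auto simp: in_set_conv_nth len)
        thus "y \<in> V" using ab \<open>p \<in> V\<close> inV[of i] by (simp add: nth)
      qed
      fix j i assume ij: "j < length xs" "i < j"
      consider "i = 0" "j = 1" | "i = 0" "j = 2" | "i = 1" "j = 2" | "i < 2" "j \<ge> 3" | "i = 2" "j = 3"
        | "i = 2" "j \<ge> 4" | "i \<ge> 3" using ij by linarith
      thus "E (ys ! i) (ys ! j) \<longleftrightarrow> j = i + 1"
      proof cases
        case 1 thus ?thesis using nth[of 0] nth[of 1] l0 ab(3) sym by auto
      next
        case 2 thus ?thesis using nth[of 0] nth[of 2] l0 \<open>\<not> E p b\<close> sym by auto
      next
        case 3 thus ?thesis using nth[of 1] nth[of 2] l0 \<open>E p a\<close> sym by auto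
      next
        case 4
        have "E (ys ! i) (ys ! j) = E (xs ! (1 - i)) (xs ! j)"
          using ij l0 4 nth[of i] nth[of j] by (cases i) (auto simp: a_def b_def)
        thus ?thesis using pth(3)[of "1 - i" j] ij 4 by auto
      next
        case 5 thus ?thesis using nth[of 2] nth[of 3] l0 ij p3 by auto
      next
        case 6 thus ?thesis using nth[of 2] nth[of j] l0 ij pj[of j] by auto
      next
        case 7 thus ?thesis using nth[of i] nth[of j] ij pth(3)[of i j] by auto
      qed
    qed
    moreover have "ys ! 0 = b" "ys ! 1 = a" "ys ! 2 = p" using nth[of 0] nth[of 1] nth[of 2] l0 by auto
    ultimately show ?thesis
      using longest_induced_path_end[OF sym irr hf, of ys q] len l2 mx that sym by metis
  qed
  with ab show ?thesis by blast
qed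

subsection \<open>Trigraphs\<close>

text \<open>Only the strong edges of the complement: switchable pairs count as non-edges, since an
  even pair has to be strongly antiadjacent.\<close>

definition strong_coadj :: "'a set \<Rightarrow> ('a \<Rightarrow> 'a \<Rightarrow> int) \<Rightarrow> 'a \<Rightarrow> 'a \<Rightarrow> bool" where
  "strong_coadj V th u v \<longleftrightarrow> u \<in> V \<and> v \<in> V \<and> strongly_anti th u v"

lemma
  assumes "trigraph V th" "u \<in> V" "v \<in> V"
  shows adj_sym: "adj th u v \<longleftrightarrow> adj th v u"
    and antiadj_sym: "antiadj th u v \<longleftrightarrow> antiadj th v u"
    and semiadj_sym: "semiadj th u v \<longleftrightarrow> semiadj th v u"
    and strongly_anti_sym: "strongly_anti th u v \<longleftrightarrow> strongly_anti th v u"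
    and not_adj_iff: "u \<noteq> v \<Longrightarrow> \<not> adj th u v \<longleftrightarrow> strongly_anti th u v"
    and antiadj_iff: "antiadj th u v \<longleftrightarrow> strongly_anti th u v \<or> semiadj th u v"
  using assms unfolding trigraph_def adj_def antiadj_def semiadj_def strongly_anti_def
  by fastforce+

definition co_triangles_strong :: "'a set \<Rightarrow> ('a \<Rightarrow> 'a \<Rightarrow> int) \<Rightarrow> bool" where
  "co_triangles_strong V th \<longleftrightarrow> (\<forall>u\<in>V. \<forall>v\<in>V. \<forall>w\<in>V.
     antiadj th u v \<and> antiadj th u w \<and> antiadj th v w \<longrightarrow> strongly_anti th u v)"

text \<open>The missing edge \<open>r s\<close> of the diamond may be switchable, so equal or
  strongly antiadjacent \<open>r\<close>, \<open>s\<close> are the only possibilities left.\<close>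

definition co_diamond_free :: "'a set \<Rightarrow> ('a \<Rightarrow> 'a \<Rightarrow> int) \<Rightarrow> bool" where
  "co_diamond_free V th \<longleftrightarrow> (\<forall>p\<in>V. \<forall>q\<in>V. \<forall>r\<in>V. \<forall>s\<in>V.
     antiadj th p q \<and> antiadj th p r \<and> antiadj th q r \<and> antiadj th p s \<and> antiadj th q s \<longrightarrow> \<not> adj th r s)"

lemma strong_coadj_sym: "trigraph V th \<Longrightarrow> strong_coadj V th u v = strong_coadj V th v u"
  using strongly_anti_sym[of V th u v] by (auto simp: strong_coadj_def)

lemma strong_coadj_irrefl: "\<not> strong_coadj V th u u"
  by (simp add: strong_coadj_def strongly_anti_def)

text \<open>Distinct vertices that are not strongly antiadjacent are adjacent, so a hole of this
  graph is an antihole of the trigraph even where its non-edges are switchable.\<close>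

lemma hole_free_strong_coadj:
  assumes tri: "trigraph V th" and "\<not> has_antihole V th"
  shows "hole_free V (strong_coadj V th)"
  unfolding hole_free_def
proof (intro notI, elim exE conjE)
  fix k h
  assume k: "k \<ge> 5" and h: "inj_on h {0..<k}" "h ` {0..<k} \<subseteq> V"
    and E: "\<forall>i<k. \<forall>j<k. i \<noteq> j \<longrightarrow> (strong_coadj V th (h i) (h j) \<longleftrightarrow> cyc_adj_idx k i j)"
  have "(cyc_adj_idx k i j \<longrightarrow> adj (compl_th th) (h i) (h j)) \<and>
        (\<not> cyc_adj_idx k i j \<longrightarrow> antiadj (compl_th th) (h i) (h j))"
    if "i < k" "j < k" "i \<noteq> j" for i j
  proof -
    have "h i \<in> V" "h j \<in> V" "h i \<noteq> h j" using h that by (auto simp: inj_on_def)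
    thus ?thesis using E[rule_format, OF that] not_adj_iff[OF tri, of "h i" "h j"]
      by (auto simp: strong_coadj_def strongly_anti_def adj_def antiadj_def compl_th_def)
  qed
  with k h have "has_hole_len V (compl_th th) k"
    unfolding has_hole_len_def by (intro conjI exI[of _ h]) auto
  hence "has_antihole V th" by (auto simp: has_antihole_def has_antihole_len_def)
  with assms show False by simp
qed

section \<open>Criteria for even pairs and the shape of the switchable component\<close>

text \<open>An odd path with at least six vertices has p (0), p (2), p (4), p (5) as a diamond of the complement.\<close>

lemma even_pairI:
  assumes diamond: "co_diamond_free V th"
    and uv: "u \<in> V" "v \<in> V" "strongly_anti th u v"
    and P4: "\<And>a b. \<lbrakk>a \<in> V; b \<in> V; adj th u a; antiadj th u b; adj th a b; antiadj th a v; adj th b v\<rbrakk> \<Longrightarrow> False"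
  shows "even_pair V th u v"
  unfolding even_pair_def
proof (intro conjI allI impI uv)
  fix ps assume "is_path V th ps \<and> hd ps = u \<and> last ps = v"
  hence ps: "ps \<noteq> []" "set ps \<subseteq> V" "hd ps = u" "last ps = v"
    and edge: "\<And>i. Suc i < length ps \<Longrightarrow> adj th (ps ! i) (ps ! Suc i)"
    and nonedge: "\<And>i j. Suc i < j \<Longrightarrow> j < length ps \<Longrightarrow> antiadj th (ps ! i) (ps ! j)"
    by (auto simp: is_path_def)
  have inV: "ps ! i \<in> V" if "i < length ps" for i using that ps(2) by auto
  have ends: "ps ! 0 = u" "ps ! (length ps - 1) = v" using ps by (auto simp: hd_conv_nth last_conv_nth)
  show "even (length ps - 1)"
  proof (rule ccontr)
    assume "odd (length ps - 1)"
    then obtain m where "length ps - 1 = 2 * m + 1" by (rule oddE)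
    hence m: "length ps = 2 * m + 2" using ps(1) by (cases ps) auto
    \<comment> \<open>Length 1 contradicts strong antiadjacency, length 3 is excluded by
      \<open>P4\<close>, and longer odd paths by the diamond.\<close>
    consider "m = 0" | "m = 1" | "2 \<le> m" by linarith
    thus False
    proof cases
      case 1
      thus False using edge[of 0] ends m uv(3) by (auto simp: adj_def strongly_anti_def)
    next
      case 2
      hence l: "length ps = 4" using m by simp
      show False
      proof (rule P4[of "ps ! 1" "ps ! 2"])
        show "ps ! 1 \<in> V" "ps ! 2 \<in> V" using inV l by auto
        show "adj th u (ps ! 1)" "adj th (ps ! 1) (ps ! 2)" "adj th (ps ! 2) v"
          using edge[of 0] edge[of 1] edge[of 2] l ends by (auto simp: numeral_2_eq_2 numeral_3_eq_3)
        show "antiadj th u (ps ! 2)" "antiadj th (ps ! 1) v"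
          using nonedge[of 0 2] nonedge[of 1 3] l ends by auto
      qed
    next
      case 3
      have "\<not> adj th (ps ! 4) (ps ! 5)"
      proof -
        have "ps ! 0 \<in> V" "ps ! 2 \<in> V" "ps ! 4 \<in> V" "ps ! 5 \<in> V" using 3 m by (auto intro!: inV)
        moreover have "antiadj th (ps ! 0) (ps ! 2)" "antiadj th (ps ! 0) (ps ! 4)" "antiadj th (ps ! 2) (ps ! 4)"
          "antiadj th (ps ! 0) (ps ! 5)" "antiadj th (ps ! 2) (ps ! 5)" using 3 m by (auto intro!: nonedge)
        ultimately show ?thesis using diamond unfolding co_diamond_free_def by blast
      qed
      thus False using edge[of 4] 3 m by simp
    qed
  qed
qed

text \<open>A light component is impossible: the middle vertex and its two switchable neighbours,
  which are strongly antiadjacent, would be a triangle of the complement that is not strong.\<close>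

lemma switchable_component_cases:
  assumes F: "in_F V th"
    and triangle: "co_triangles_strong V th"
  obtains (none) "swD V th = {}" "\<And>u v. u \<in> V \<Longrightarrow> v \<in> V \<Longrightarrow> \<not> semiadj th u v"
    | (small) x y where "x \<in> V" "y \<in> V" "semiadj th x y" "swD V th = {x, y}" "small_D V th x y"
      "nbhd V th x \<inter> nbhd V th y = {}" "\<And>u v. u \<in> V \<Longrightarrow> v \<in> V \<Longrightarrow> semiadj th u v \<Longrightarrow> {u, v} = {x, y}"
proof (cases "\<exists>u\<in>V. \<exists>v\<in>V. semiadj th u v")
  case False
  hence no: "sw_edges V th = {}" by (auto simp: sw_edges_def)
  have "\<not> 2 \<le> card (sw_comp V th x)" for x
  proof -
    have "y = x" if "(\<lambda>a b. {a, b} \<in> sw_edges V th)\<^sup>*\<^sup>* x y" for y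
      using that by (induction rule: rtranclp_induct) (auto simp: no)
    hence "sw_comp V th x \<subseteq> {x}" by (auto simp: sw_comp_def)
    hence "card (sw_comp V th x) \<le> card {x}" by (intro card_mono) auto
    thus ?thesis by simp
  qed
  hence "sw_components V th = {}"
    unfolding sw_components_def by blast
  hence "swD V th = {}" by (simp add: swD_def)
  thus thesis using none False by blast
next
  case True
  then obtain x y where xy: "x \<in> V" "y \<in> V" "semiadj th x y" by blast
  have tri: "trigraph V th" and finV: "finite V" using F by (auto simp: in_F_def trigraph_def)
  have ne: "x \<noteq> y" using xy by (simp add: semiadj_def)
  let ?C = "sw_comp V th x" and ?R = "\<lambda>a b. {a, b} \<in> sw_edges V th"
  have step_V: "a \<in> V \<and> b \<in> V \<and> semiadj th a b" if "{a, b} \<in> sw_edges V th" for a b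
    using that semiadj_sym[OF tri] by (auto simp: sw_edges_def doubleton_eq_iff)
  have comp: "sw_comp V th u \<in> sw_components V th \<and> {u, v} \<subseteq> sw_comp V th u"
    if "u \<in> V" "v \<in> V" "semiadj th u v" for u v
  proof -
    have "{u, v} \<in> sw_edges V th" using that by (auto simp: sw_edges_def)
    hence sub: "{u, v} \<subseteq> sw_comp V th u" using that by (auto simp: sw_comp_def)
    moreover have "finite (sw_comp V th u)" using finV by (simp add: sw_comp_def)
    ultimately have "card {u, v} \<le> card (sw_comp V th u)" by (intro card_mono)
    moreover have "u \<noteq> v" using that by (simp add: semiadj_def)
    ultimately show ?thesis using sub that by (auto simp: sw_components_def)
  qed
  have finC: "finite (sw_components V th)"
    by (rule finite_surj[OF finV, of _ "sw_comp V th"]) (auto simp: sw_components_def)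
  have only: "C = ?C" if "C \<in> sw_components V th" for C
  proof -
    have "card (sw_components V th) \<le> Suc 0" using F by (simp add: in_F_def)
    thus ?thesis using that comp[OF xy] card_le_Suc0_iff_eq[OF finC] by blast
  qed
  have comps: "sw_components V th = {?C}" using only comp[OF xy] by auto
  have edges: "comp_edges V th ?C = sw_edges V th"
  proof
    show "sw_edges V th \<subseteq> comp_edges V th ?C"
    proof
      fix e assume e: "e \<in> sw_edges V th"
      then obtain u v where uv: "e = {u, v}" "u \<in> V" "v \<in> V" "semiadj th u v" by (auto simp: sw_edges_def)
      from comp[OF uv(2-)] only have "e \<subseteq> ?C" using uv(1) by auto
      with e show "e \<in> comp_edges V th ?C" by (simp add: comp_edges_def)
    qed
  qed (auto simp: comp_edges_def)
  have exy: "{x, y} \<in> sw_edges V th" using xy by (auto simp: sw_edges_def)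
  \<comment> \<open>Reachability in the form of an induction: a set that contains \<open>x\<close>
    and is closed under switchable edges contains the component.\<close>
  have reach: "z \<in> S" if "z \<in> ?C" "x \<in> S" "\<And>a b. a \<in> S \<Longrightarrow> {a, b} \<in> sw_edges V th \<Longrightarrow> b \<in> S" for z S
  proof -
    from that(1) have "?R\<^sup>*\<^sup>* x z" by (simp add: sw_comp_def)
    thus ?thesis by (induction rule: rtranclp_induct) (use that in blast)+
  qed
  have "sw_edges V th = {{x, y}}"
  proof (rule ccontr)
    assume "sw_edges V th \<noteq> {{x, y}}"
    with exy obtain e where e: "e \<in> sw_edges V th" "e \<noteq> {x, y}" by blast
    have "finite (sw_edges V th)"
      by (rule finite_subset[of _ "Pow V"]) (use finV in \<open>auto simp: sw_edges_def\<close>)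
    moreover have "card (sw_edges V th) \<le> 2" using F comps edges by (auto simp: in_F_def)
    ultimately have two: "{{x, y}, e} = sw_edges V th"
      using e exy by (intro card_seteq) auto
    obtain s t where st: "e = {s, t}" "s \<in> V" "t \<in> V" "semiadj th s t" using e by (auto simp: sw_edges_def)
    \<comment> \<open>Were the two edges disjoint, \<open>{x, y}\<close> would be closed under
      switchable edges and \<open>e\<close> out of reach.\<close>
    have "e \<inter> {x, y} \<noteq> {}"
    proof
      assume dj: "e \<inter> {x, y} = {}"
      have "e \<in> comp_edges V th ?C" using edges e by simp
      hence "s \<in> ?C" using st(1) by (auto simp: comp_edges_def)
      hence "s \<in> {x, y}"
        by (rule reach[of s "{x, y}"]) (use two[symmetric] dj in \<open>auto simp: doubleton_eq_iff\<close>)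
      thus False using dj st by auto
    qed
    then obtain v a b where vab: "{{x, y}, e} = {{v, a}, {v, b}}" "a \<noteq> b"
      using st(1) e(2) ne by (auto simp: doubleton_eq_iff)
    have "strongly_anti th a b"
    proof -
      have "comp_edges V th ?C = {{v, a}, {v, b}}" using edges two vab(1) by simp
      moreover have "?C \<in> sw_components V th" using comps by simp
      ultimately show ?thesis using F vab(2) unfolding in_F_def by blast
    qed
    moreover have "{v, a} \<in> sw_edges V th" "{v, b} \<in> sw_edges V th" using two vab by auto
    ultimately show False
      using triangle[unfolded co_triangles_strong_def, rule_format, of v a b] step_V[of v a] step_V[of v b]
      by (auto simp: antiadj_def semiadj_def strongly_anti_def)
  qed
  note all = this
  have "?C = {x, y}"
  proof
    show "?C \<subseteq> {x, y}"
      using reach[of _ "{x, y}"] all by (auto simp: doubleton_eq_iff)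
  qed (use comp[OF xy] in auto)
  hence "swD V th = {x, y}" using comps by (simp add: swD_def)
  moreover have "small_D V th x y" using comps edges all by (auto simp: small_D_def)
  moreover have "nbhd V th x \<inter> nbhd V th y = {}" using F comps edges all by (auto simp: in_F_def)
  moreover have "{u, v} = {x, y}" if "u \<in> V" "v \<in> V" "semiadj th u v" for u v
  proof -
    have "{u, v} \<in> sw_edges V th" using that by (auto simp: sw_edges_def)
    thus ?thesis using all by simp
  qed
  ultimately show thesis using small xy by blast
qed

text \<open>In a path u, a, b, v both non-consecutive pairs are automatically strong: a switchable pair
  has no common neighbour.\<close>

lemma even_pair_strongI:
  assumes F: "in_F V th"
    and triangle: "co_triangles_strong V th"
    and diamond: "co_diamond_free V th"
    and uv: "strong_coadj V th u v"
    and P4: "\<And>a b. \<lbrakk>adj th u a; adj th a b; adj th b v; strong_coadj V th u b; strong_coadj V th a v\<rbrakk> \<Longrightarrow> False"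
  shows "even_pair V th u v"
proof (rule even_pairI[OF diamond])
  have tri: "trigraph V th" using F by (auto simp: in_F_def)
  have no_common: "\<not> semiadj th s t" if "s \<in> V" "t \<in> V" "w \<in> V" "adj th s w" "adj th t w" for s t w
  proof
    assume "semiadj th s t"
    from F triangle show False
    proof (cases rule: switchable_component_cases)
      case none
      thus False using that \<open>semiadj th s t\<close> by blast
    next
      case (small x y)
      have "{s, t} = {x, y}" using small that \<open>semiadj th s t\<close> by blast
      hence "w \<in> nbhd V th x \<inter> nbhd V th y" using that by (auto simp: nbhd_def doubleton_eq_iff)
      thus False using small by blast
    qed
  qed
  show "u \<in> V" "v \<in> V" "strongly_anti th u v" using uv by (auto simp: strong_coadj_def)
  fix a b
  assume ab: "a \<in> V" "b \<in> V" "adj th u a" "antiadj th u b" "adj th a b" "antiadj th a v" "adj th b v"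
  have "\<not> semiadj th u b" using no_common[of u b a] ab \<open>u \<in> V\<close> adj_sym[OF tri, of a b] by blast
  moreover have "\<not> semiadj th a v" using no_common[of a v b] ab \<open>v \<in> V\<close> adj_sym[OF tri, of b v] by blast
  ultimately show False
    using P4[OF ab(3,5,7)] ab antiadj_iff[OF tri, of u b] antiadj_iff[OF tri, of a v] \<open>u \<in> V\<close> \<open>v \<in> V\<close>
    by (auto simp: strong_coadj_def)
qed

subsection \<open>Complements of line and bipartite trigraphs\<close>

text \<open>Every vertex is an edge of a bipartite graph, given by its ends \<open>l\<close> and
  \<open>r\<close> in the two sides, like a cell of a grid. Antiadjacency means sharing a row or a
  column.\<close>

lemma line_coordinates:
  fixes V :: "'a set"
  assumes "full_real_is_line_of_bipartite V (compl_th th)"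
  shows "\<exists>(l :: 'a \<Rightarrow> nat) (r :: 'a \<Rightarrow> nat). \<forall>u\<in>V. \<forall>v\<in>V. (u \<noteq> v \<longrightarrow> (antiadj th u v \<longleftrightarrow> l u = l v \<or> r u = r v)) \<and>
    (l u = l v \<and> r u = r v \<longrightarrow> u = v)"
proof -
  obtain E :: "nat set set" and f where bip: "bipartite_graph E" and f: "bij_betw f V E"
    and adj: "\<And>u v. u \<in> V \<Longrightarrow> v \<in> V \<Longrightarrow> u \<noteq> v \<Longrightarrow> adj (compl_th th) u v \<longleftrightarrow> f u \<inter> f v \<noteq> {}"
    using assms unfolding full_real_is_line_of_bipartite_def by blast
  obtain A where A: "\<And>e. e \<in> E \<Longrightarrow> card e = 2 \<and> card (e \<inter> A) = 1"
    using bip unfolding bipartite_graph_def by blast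
  have "\<exists>a b. f u = {a, b} \<and> a \<in> A \<and> b \<notin> A" if "u \<in> V" for u
  proof -
    have "f u \<in> E" using f that by (auto simp: bij_betw_def)
    with A have c: "card (f u) = 2" "card (f u \<inter> A) = 1" by blast+
    obtain a where a: "f u \<inter> A = {a}" using c(2) card_1_singletonE by blast
    obtain s t where st: "f u = {s, t}" "s \<noteq> t" using c(1) card_2_iff by metis
    show ?thesis
    proof (cases "s \<in> A")
      case True
      hence "t \<notin> A" using a st by auto
      thus ?thesis using True st by blast
    next
      case False
      hence "t \<in> A" using a st by auto
      thus ?thesis using False st by blast
    qed
  qed
  then obtain l r where lr: "\<And>u. u \<in> V \<Longrightarrow> f u = {l u, r u} \<and> l u \<in> A \<and> r u \<notin> A" by metis
  have meet: "f u \<inter> f v \<noteq> {} \<longleftrightarrow> l u = l v \<or> r u = r v" if "u \<in> V" "v \<in> V" for u v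
  proof -
    have "l u \<noteq> r v" "r u \<noteq> l v" using lr[OF that(1)] lr[OF that(2)] by auto
    thus ?thesis using lr[OF that(1)] lr[OF that(2)] by auto
  qed
  have "(u \<noteq> v \<longrightarrow> (antiadj th u v \<longleftrightarrow> l u = l v \<or> r u = r v)) \<and> (l u = l v \<and> r u = r v \<longrightarrow> u = v)"
    if uv: "u \<in> V" "v \<in> V" for u v
  proof (intro conjI impI)
    show "antiadj th u v \<longleftrightarrow> l u = l v \<or> r u = r v" if "u \<noteq> v"
      using adj[OF uv that] meet[OF uv] by (auto simp: adj_def antiadj_def compl_th_def)
    show "u = v" if "l u = l v \<and> r u = r v"
      using lr[OF uv(1)] lr[OF uv(2)] that f uv by (auto simp: bij_betw_def inj_on_def)
  qed
  thus ?thesis by blast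
qed

definition co_claw_free :: "'a set \<Rightarrow> ('a \<Rightarrow> 'a \<Rightarrow> int) \<Rightarrow> bool" where
  "co_claw_free V th \<longleftrightarrow> (\<forall>y\<in>V. \<forall>a\<in>V. \<forall>b\<in>V. \<forall>c\<in>V.
     a \<noteq> b \<and> a \<noteq> c \<and> b \<noteq> c \<and> antiadj th y a \<and> antiadj th y b \<and> antiadj th y c \<longrightarrow>
     antiadj th a b \<or> antiadj th a c \<or> antiadj th b c)"

lemma antiadj_neq: "antiadj th u v \<Longrightarrow> u \<noteq> v"
  by (simp add: antiadj_def)

text \<open>Claw: two of three cells meeting \<open>y\<close> share the same coordinate with it,
  hence with each other. Diamond: \<open>p\<close> and \<open>q\<close> agree in exactly one
  coordinate, and cells meeting both must share it. Triangles are strong by the clique condition on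
  line trigraphs.\<close>

lemma compl_line_tri_properties:
  fixes V :: "'a set"
  assumes tri: "trigraph V th" and line: "compl_line_tri V th"
  shows "co_triangles_strong V th" "co_diamond_free V th" "co_claw_free V th"
proof -
  have lt: "full_real_is_line_of_bipartite V (compl_th th)"
    "\<And>X. X \<subseteq> V \<Longrightarrow> clique (compl_th th) X \<Longrightarrow> card X \<ge> 3 \<Longrightarrow> strong_clique (compl_th th) X"
    using line by (simp_all add: compl_line_tri_def line_tri_def)
  obtain l r :: "'a \<Rightarrow> nat" where lr: "\<And>u v. u \<in> V \<Longrightarrow> v \<in> V \<Longrightarrow> u \<noteq> v \<Longrightarrow> antiadj th u v \<longleftrightarrow> l u = l v \<or> r u = r v"
    and inj: "\<And>u v. u \<in> V \<Longrightarrow> v \<in> V \<Longrightarrow> l u = l v \<Longrightarrow> r u = r v \<Longrightarrow> u = v"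
    using line_coordinates[OF lt(1)] by blast
  show strong: "co_triangles_strong V th"
    unfolding co_triangles_strong_def
  proof (intro ballI impI, elim conjE)
    fix u v w assume *: "u \<in> V" "v \<in> V" "w \<in> V" "antiadj th u v" "antiadj th u w" "antiadj th v w"
    hence "clique (compl_th th) {u, v, w}"
      using antiadj_sym[OF tri] by (auto simp: clique_def adj_def antiadj_def compl_th_def)
    moreover have "card {u, v, w} = 3" using *(4-6)[THEN antiadj_neq] by simp
    ultimately have "strong_clique (compl_th th) {u, v, w}" using lt(2)[of "{u, v, w}"] * by simp
    thus "strongly_anti th u v" using antiadj_neq[OF *(4)]
      by (auto simp: strong_clique_def strongly_adj_def strongly_anti_def compl_th_def)
  qed
  show "co_claw_free V th"
    unfolding co_claw_free_def
  proof (intro ballI impI, elim conjE)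
    fix y a b c assume *: "y \<in> V" "a \<in> V" "b \<in> V" "c \<in> V" "a \<noteq> b" "a \<noteq> c" "b \<noteq> c"
      "antiadj th y a" "antiadj th y b" "antiadj th y c"
    have "l y = l a \<or> r y = r a" "l y = l b \<or> r y = r b" "l y = l c \<or> r y = r c"
      using * lr antiadj_neq by metis+
    thus "antiadj th a b \<or> antiadj th a c \<or> antiadj th b c" using * lr by metis
  qed
  show "co_diamond_free V th"
    unfolding co_diamond_free_def
  proof (intro ballI impI, elim conjE)
    fix p q r' s assume *: "p \<in> V" "q \<in> V" "r' \<in> V" "s \<in> V" "antiadj th p q" "antiadj th p r'"
      "antiadj th q r'" "antiadj th p s" "antiadj th q s"
    show "\<not> adj th r' s"
    proof
      assume rs: "adj th r' s"
      hence "r' \<noteq> s" by (simp add: adj_def)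
      have e: "l p = l q \<or> r p = r q" "l p = l r' \<or> r p = r r'" "l q = l r' \<or> r q = r r'"
        "l p = l s \<or> r p = r s" "l q = l s \<or> r q = r s" "p \<noteq> q"
        using * lr antiadj_neq by metis+
      hence "l r' = l s \<or> r r' = r s" using inj[OF *(1,2)] by metis
      hence "antiadj th r' s" using lr[OF *(3,4) \<open>r' \<noteq> s\<close>] by blast
      \<comment> \<open>The pair could still be switchable, but it lies in a triangle of the
        complement with \<open>p\<close>.\<close>
      hence "strongly_anti th r' s"
        using strong * antiadj_sym[OF tri, of p r'] antiadj_sym[OF tri, of p s]
        unfolding co_triangles_strong_def by blast
      with rs show False by (simp add: adj_def strongly_anti_def)
    qed
  qed
qed

section \<open>Complements of bipartite trigraphs have no triangle of antiadjacent pairs\<close>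

lemma compl_bipartite_tri_sides:
  assumes "compl_bipartite_tri V th"
  shows "\<exists>A B. A \<inter> B = {} \<and> A \<union> B = V \<and> (\<forall>u\<in>A. \<forall>v\<in>A. \<not> antiadj th u v) \<and> (\<forall>u\<in>B. \<forall>v\<in>B. \<not> antiadj th u v)"
proof -
  obtain A B where AB: "A \<union> B = V" "A \<inter> B = {}" "strongly_stable (compl_th th) A" "strongly_stable (compl_th th) B"
    using assms unfolding compl_bipartite_tri_def bipartite_tri_def by blast
  have "\<forall>u\<in>X. \<forall>v\<in>X. \<not> antiadj th u v" if "strongly_stable (compl_th th) X" for X
    using that by (auto simp: strongly_stable_def strongly_anti_def antiadj_def compl_th_def)
  with AB show ?thesis by (intro exI[of _ A] exI[of _ B]) simp
qed

lemma compl_bipartite_tri_no_triple: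
  assumes "compl_bipartite_tri V th" "u \<in> V" "v \<in> V" "w \<in> V"
    and "antiadj th u v" "antiadj th u w" "antiadj th v w"
  shows False
proof -
  obtain A B where "A \<union> B = V" "\<forall>u\<in>A. \<forall>v\<in>A. \<not> antiadj th u v" "\<forall>u\<in>B. \<forall>v\<in>B. \<not> antiadj th u v"
    using compl_bipartite_tri_sides[OF assms(1)] by blast
  with assms(2-) show False by blast
qed

lemma compl_bipartite_tri_properties:
  assumes "compl_bipartite_tri V th"
  shows "co_triangles_strong V th" "co_diamond_free V th"
  using compl_bipartite_tri_no_triple[OF assms]
  unfolding co_triangles_strong_def co_diamond_free_def by blast+

section \<open>Even pairs in the two classes\<close>

lemma compl_bipartite_even_pair:
  assumes F: "in_F V th" and anti: "\<not> has_antihole V th" and bip: "compl_bipartite_tri V th"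
    and edge: "strong_coadj V th u0 v0"
  shows "\<exists>u v. even_pair V th u v"
proof -
  have tri: "trigraph V th" using F by (simp add: in_F_def)
  obtain A B where AB: "A \<inter> B = {}" "A \<union> B = V"
    and stable: "\<forall>u\<in>A. \<forall>v\<in>A. \<not> antiadj th u v" "\<forall>u\<in>B. \<forall>v\<in>B. \<not> antiadj th u v"
    using compl_bipartite_tri_sides[OF bip] by blast
  let ?E = "strong_coadj V th"
  have sym: "?E u v = ?E v u" for u v by (rule strong_coadj_sym[OF tri])
  have E_anti: "?E u v \<Longrightarrow> antiadj th u v" for u v
    by (auto simp: strong_coadj_def strongly_anti_def antiadj_def)
  have stableE: "\<not> ?E u v" if "u \<in> A \<and> v \<in> A \<or> u \<in> B \<and> v \<in> B" for u v using E_anti stable that by blast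
  obtain s t where st: "s \<in> A" "t \<in> B" "?E s t"
    using edge sym stableE AB(2) unfolding strong_coadj_def by (metis UnE)
  have "finite V" using tri by (simp add: trigraph_def)
  then obtain u v where uv: "u \<in> A" "v \<in> B" "?E u v"
    "\<And>u' v'. u' \<in> A \<Longrightarrow> v' \<in> B \<Longrightarrow> ?E u v' \<Longrightarrow> ?E u' v \<Longrightarrow> ?E u' v'"
    using hole_free_bipartite_bisimplicial_edge[OF _ hole_free_strong_coadj[OF tri anti] AB sym _ _ st] stableE
    by metis
  have "even_pair V th u v"
  proof (rule even_pair_strongI[OF F compl_bipartite_tri_properties[OF bip] uv(3)])
    fix a b assume *: "adj th a b" "?E u b" "?E a v"
    \<comment> \<open>Strongly antiadjacent vertices lie on opposite sides, so the bisimplicial edge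
      \<open>u v\<close> forces the middle pair of the path to be strongly antiadjacent.\<close>
    have "b \<in> B" "a \<in> A" using * stableE uv(1,2) AB(2) unfolding strong_coadj_def by blast+
    hence "?E a b" using uv(4) * by blast
    with *(1) show False by (auto simp: strong_coadj_def strongly_anti_def adj_def)
  qed
  thus ?thesis by blast
qed

lemma compl_line_even_pair:
  assumes F: "in_F V th" and anti: "\<not> has_antihole V th" and line: "compl_line_tri V th"
    and edge: "strong_coadj V th u0 v0"
  shows "\<exists>u v. even_pair V th u v"
proof -
  have tri: "trigraph V th" using F by (simp add: in_F_def)
  note props = compl_line_tri_properties[OF tri line]
  let ?E = "strong_coadj V th"
  have sym: "?E u v = ?E v u" for u v by (rule strong_coadj_sym[OF tri])
  have E_anti: "?E u v \<Longrightarrow> antiadj th u v" for u v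
    by (auto simp: strong_coadj_def strongly_anti_def antiadj_def)
  have E_adj: "\<not> ?E u v" if "adj th u v" for u v
    using that by (auto simp: strong_coadj_def strongly_anti_def adj_def)
  \<comment> \<open>Claw-freeness only yields antiadjacent pairs; the triangle with \<open>y\<close>
    makes them strong.\<close>
  have lift: "?E a b" if "antiadj th a b" "?E y a" "?E y b" for y a b
    using that props(1) E_anti antiadj_sym[OF tri, of y a] antiadj_sym[OF tri, of y b]
    unfolding co_triangles_strong_def strong_coadj_def by metis
  have claw: "?E a b \<or> ?E a c \<or> ?E b c"
    if "y \<in> V" "a \<in> V" "b \<in> V" "c \<in> V" "a \<noteq> b" "a \<noteq> c" "b \<noteq> c" "?E y a" "?E y b" "?E y c" for y a b c
    using props(3) that E_anti lift unfolding co_claw_free_def by metis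
  have "finite V" using tri by (simp add: trigraph_def)
  have "\<exists>u\<in>V. \<exists>v\<in>V. ?E u v \<and>
    (\<forall>p\<in>V. \<forall>q\<in>V. ?E p u \<and> p \<noteq> v \<and> \<not> ?E p v \<and> ?E v q \<and> q \<noteq> u \<and> \<not> ?E q u \<and> p \<noteq> q \<longrightarrow> ?E p q)"
  proof (rule claw_free_edge_no_central_P4[OF \<open>finite V\<close> sym strong_coadj_irrefl hole_free_strong_coadj[OF tri anti]])
    show "u0 \<in> V" "v0 \<in> V" "?E u0 v0" using edge by (auto simp: strong_coadj_def)
  qed (rule claw)
  then obtain u v where uv: "?E u v"
    "\<And>p q. \<lbrakk>p \<in> V; q \<in> V; ?E p u; p \<noteq> v; \<not> ?E p v; ?E v q; q \<noteq> u; \<not> ?E q u; p \<noteq> q\<rbrakk> \<Longrightarrow> ?E p q"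
    by blast
  have "even_pair V th u v"
  proof (rule even_pair_strongI[OF F props(1,2) uv(1)])
    fix a b assume *: "adj th u a" "adj th a b" "adj th b v" "?E u b" "?E a v"
    have ne: "a \<noteq> b" "b \<noteq> v" "a \<noteq> u" using * by (auto simp: adj_def)
    have "a \<in> V" "b \<in> V" using * by (auto simp: strong_coadj_def)
    moreover have "\<not> ?E b v" "\<not> ?E a u" using E_adj * sym by blast+
    \<comment> \<open>A path \<open>u, a, b, v\<close> appears in the complement as
      \<open>b, u, v, a\<close>, with \<open>u v\<close> in the middle.\<close>
    ultimately have "?E b a" using uv(2)[of b a] ne * sym by blast
    with *(2) E_adj sym show False by blast
  qed
  thus ?thesis by blast
qed

text \<open>Two strong co-neighbours u, v of x that are strongly antiadjacent: in a path u, a, b, v the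
  vertices a, b must be co-neighbours of y, and y, x, a, b is a claw in the complement.\<close>

lemma compl_line_small_even_pair:
  assumes F: "in_F V th" and line: "compl_line_tri V th"
    and xy: "x \<in> V" "y \<in> V" "semiadj th x y" "nbhd V th x \<inter> nbhd V th y = {}"
    and only: "\<And>s t. s \<in> V \<Longrightarrow> t \<in> V \<Longrightarrow> semiadj th s t \<Longrightarrow> {s, t} = {x, y}"
    and nc: "\<not> clique th (V - ({x, y} \<union> nbhd V th x))"
  shows "\<exists>u v. even_pair V th u v \<and> {u, v} \<inter> {x, y} = {}"
proof -
  have tri: "trigraph V th" using F by (simp add: in_F_def)
  note props = compl_line_tri_properties[OF tri line]
  let ?E = "strong_coadj V th"
  have sym: "?E u v = ?E v u" for u v by (rule strong_coadj_sym[OF tri])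
  have E_anti: "antiadj th u v" "antiadj th v u" if "?E u v" for u v
    using that sym by (auto simp: strong_coadj_def strongly_anti_def antiadj_def)
  have E_adj: "\<not> ?E u v" if "adj th u v" for u v
    using that by (auto simp: strong_coadj_def strongly_anti_def adj_def)
  have E_iff: "?E s t \<longleftrightarrow> \<not> adj th s t" if "s \<in> V" "t \<in> V" "s \<noteq> t" for s t
    using not_adj_iff[OF tri that] that by (simp add: strong_coadj_def)
  have anti_iff: "antiadj th s t \<longleftrightarrow> ?E s t" if "s \<in> V" "t \<in> V" "s \<notin> {x, y}" for s t
    using antiadj_iff[OF tri that(1,2)] only[OF that(1,2)] that by (auto simp: strong_coadj_def)
  have xy_anti: "antiadj th x y" "antiadj th y x" using xy(3) antiadj_iff[OF tri] semiadj_sym[OF tri] xy by blast+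
  \<comment> \<open>Such a vertex would complete the switchable pair \<open>x y\<close> to a
    triangle of the complement.\<close>
  have no_xy: "\<not> (antiadj th z x \<and> antiadj th z y)" if "z \<in> V" for z
    using props(1) that xy xy_anti antiadj_sym[OF tri] unfolding co_triangles_strong_def
    by (metis semiadj_def strongly_anti_def zero_neq_neg_one)
  have cover: "?E x z \<or> ?E y z" if "z \<in> V" "z \<notin> {x, y}" for z
    using that xy E_iff[of x z] E_iff[of y z] by (auto simp: nbhd_def)
  obtain u v where uv0: "u \<in> V" "v \<in> V" "u \<notin> {x, y}" "v \<notin> {x, y}" "u \<notin> nbhd V th x" "v \<notin> nbhd V th x"
      "u \<noteq> v" "\<not> adj th u v"
    using nc by (auto simp: clique_def)
  hence uv: "?E u v" "?E x u" "?E x v"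
    using E_iff[of u v] E_iff[of x u] E_iff[of x v] xy by (auto simp: nbhd_def)
  have "even_pair V th u v"
  proof (rule even_pair_strongI[OF F props(1,2) uv(1)])
    fix a b assume *: "adj th u a" "adj th a b" "adj th b v" "?E u b" "?E a v"
    \<comment> \<open>Stated for \<open>s\<close>, \<open>t\<close> so as to cover both inner
      vertices: \<open>b\<close> with ends \<open>u\<close>, \<open>v\<close> and, by reversing the
      path, \<open>a\<close> with ends \<open>v\<close>, \<open>u\<close>.\<close>
    have side: "w \<notin> {x, y} \<and> ?E y w \<and> \<not> ?E x w"
      if w: "?E s w" "adj th w t" and st: "s = u \<and> t = v \<or> s = v \<and> t = u" for s t w
    proof -
      have wV: "w \<in> V" using w by (simp add: strong_coadj_def)
      have S: "?E x s" "?E x t" "?E s t" "s \<in> V" "t \<in> V" using st uv sym uv0 by auto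
      have "w \<noteq> x" using w(2) S(2) E_adj by blast
      moreover have "w \<noteq> y" using no_xy[of s] S E_anti w by blast
      moreover have "\<not> ?E x w"
      proof
        assume "?E x w"
        \<comment> \<open>Otherwise \<open>w\<close> and \<open>t\<close> are the non-adjacent
          corners of a diamond of the complement on the edge \<open>x s\<close>.\<close>
        hence "\<not> adj th w t"
          using props(2) E_anti S w wV xy(1) unfolding co_diamond_free_def by blast
        with w show False by simp
      qed
      ultimately show ?thesis using cover wV by blast
    qed
    have B: "b \<notin> {x, y} \<and> ?E y b \<and> \<not> ?E x b" using side[of u b v] * by blast
    have "adj th a u" using *(1) adj_sym[OF tri, of u a] * by (auto simp: strong_coadj_def)
    hence A: "a \<notin> {x, y} \<and> ?E y a \<and> \<not> ?E x a" using side[of v a u] * sym by blast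
    have V: "a \<in> V" "b \<in> V" "a \<noteq> b" using * by (auto simp: strong_coadj_def adj_def)
    hence "antiadj th a b \<or> antiadj th a x \<or> antiadj th b x"
      using props(3) A B E_anti xy xy_anti unfolding co_claw_free_def by blast
    hence "?E a b \<or> ?E a x \<or> ?E b x" using anti_iff A B V xy by blast
    thus False using A B E_adj *(2) sym by blast
  qed
  thus ?thesis using uv0 by blast
qed

theorem theorem4p9:
  fixes V :: "'a set" and th :: "'a \<Rightarrow> 'a \<Rightarrow> int"
  assumes "in_F V th"
    and "\<not> has_antihole V th"
    and "compl_bipartite_tri V th \<or> compl_line_tri V th"
  shows "(complete V th \<or> (\<exists>u v. even_pair V th u v))
       \<and> (favorable V th \<longrightarrow>
            (\<exists>u v. even_pair V th u v \<and> {u, v} \<inter> swD V th = {}))"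
proof -
  have tri: "trigraph V th" using assms(1) by (simp add: in_F_def)
  have even: "\<exists>u v. even_pair V th u v" if "strong_coadj V th u v" for u v
    using compl_bipartite_even_pair[OF assms(1,2) _ that] compl_line_even_pair[OF assms(1,2) _ that] assms(3) by blast
  have strong: "co_triangles_strong V th"
    using assms(3) compl_bipartite_tri_properties compl_line_tri_properties[OF tri] by blast
  have "complete V th \<or> (\<exists>u v. even_pair V th u v)"
  proof (cases "complete V th")
    case False
    then obtain u v where "u \<in> V" "v \<in> V" "u \<noteq> v" "\<not> adj th u v" by (auto simp: complete_def clique_def)
    hence "strong_coadj V th u v" using not_adj_iff[OF tri, of u v] by (simp add: strong_coadj_def)
    thus ?thesis using even by blast
  qed simp
  moreover have "\<exists>u v. even_pair V th u v \<and> {u, v} \<inter> swD V th = {}" if fav: "favorable V th"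
    using assms(1) strong
  proof (cases rule: switchable_component_cases)
    case none
    from fav obtain u v where "u \<in> V" "v \<in> V" "strongly_anti th u v" unfolding favorable_def by blast
    hence "strong_coadj V th u v" by (simp add: strong_coadj_def)
    thus ?thesis using even none(1) by blast
  next
    case (small x y)
    have "\<not> clique th (V - ({x, y} \<union> nbhd V th x)) \<or> \<not> clique th (V - ({x, y} \<union> nbhd V th y))"
      using fav small(4,5) unfolding favorable_def by metis
    \<comment> \<open>\<open>z\<close> is the end of the switchable pair whose non-neighbours
      outside the component fail to be a clique.\<close>
    then obtain z z' where z: "z = x \<and> z' = y \<or> z = y \<and> z' = x" "\<not> clique th (V - ({z, z'} \<union> nbhd V th z))"
      by (metis insert_commute)
    have zV: "z \<in> V" "z' \<in> V" "semiadj th z z'" "nbhd V th z \<inter> nbhd V th z' = {}" and xy: "{x, y} = {z, z'}"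
      using z(1) small(1-3,6) semiadj_sym[OF tri small(1,2)] by auto
    from assms(3) show ?thesis
    proof
      assume bip: "compl_bipartite_tri V th"
      obtain u v where uv: "u \<in> V" "v \<in> V" "u \<noteq> z" "v \<noteq> z" "\<not> adj th z u" "\<not> adj th z v" "u \<noteq> v" "\<not> adj th u v"
        using z(2) by (auto simp: clique_def nbhd_def)
      hence "antiadj th z u" "antiadj th z v" "antiadj th u v"
        using not_adj_iff[OF tri] antiadj_iff[OF tri] zV by metis+
      \<comment> \<open>Two strongly antiadjacent non-neighbours of \<open>z\<close> form a triangle
        of the complement with it, impossible in a bipartite graph.\<close>
      hence False using compl_bipartite_tri_no_triple[OF bip zV(1) uv(1,2)] by blast
      thus ?thesis ..
    next
      assume line: "compl_line_tri V th"
      show ?thesis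
        using compl_line_small_even_pair[OF assms(1) line zV _ z(2)] small(4,7) xy by metis
    qed
  qed
  ultimately show ?thesis by blast
qed

end
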